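(* Let $d\in[1,+\infty]$ and let $(\varphi_{s,t})_{0\le s\le t<+\infty}$ be an evolution family of order $d$ in the unit disc $\mathbb{D}$. (1) For every $t>0$ there exists a set $N(t)\subset[0,t]$ of zero measure (not depending on $z$) such that, for every $s\in(0,t)\setminus N(t)$, the function $$\mathbb{D}\ni z\mapsto\frac{\partial\varphi_{s,t}(z)}{\partial s}:=\lim_{h\to0}\frac{\varphi_{s+h,t}(z)-\varphi_{s,t}(z)}{h}\in\mathbb{C}$$ is a well-defined holomorphic function on $\mathbb{D}$. (2) Let $G:\mathbb{D}\times[0,+\infty)\to\mathbb{C}$ be a Herglotz vector field whose positive trajectories are $(\varphi_{s,t})$. Fix $t>0$. Then there exists a set $N(t)\subset[0,t]$ of zero measure (not depending on $z$) such that, for every $s\in(0,t)\setminus N(t)$ and every $z\in\mathbb{D}$, $$\frac{\partial\varphi_{s,t}(z)}{\partial s}=-G(z,s)\,\varphi_{s,t}'(z),$$ where $\varphi_{s,t}'$ denotes the complex derivative with respect to $z$.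
   Context: $\mathbb{D}=\{\zeta\in\mathbb{C}:|\zeta|<1\}$. Evolution family: for $d\in[1,+\infty]$, a family $(\varphi_{s,t})_{0\le s\le t<+\infty}$ of holomorphic self-maps of $\mathbb{D}$ is an evolution family of order $d$ if (1) $\varphi_{s,s}=\mathrm{id}_{\mathbb{D}}$ for all $s\ge 0$; (2) $\varphi_{s,t}=\varphi_{u,t}\circ\varphi_{s,u}$ for all $0\le s\le u\le t<+\infty$; (3) for all $z\in\mathbb{D}$ and all $T>0$ there is a non-negative $k_{z,T}\in L^d([0,T],\mathbb{R})$ with $|\varphi_{s,u}(z)-\varphi_{s,t}(z)|\le\int_u^t k_{z,T}(\xi)\,d\xi$ for all $0\le s\le u\le t\le T$. Infinitesimal generator: a semigroup of holomorphic self-maps of $\mathbb{D}$ is a family $(\phi_t)_{t\ge0}$ of holomorphic self-maps of $\mathbb{D}$ with $\phi_0=\mathrm{id}$, $\phi_{t+s}=\phi_t\circ\phi_s$, and $\phi_t\to\mathrm{id}$ uniformly on compact sets as $t\to0$; its infinitesimal generator is the unique holomorphic $F:\mathbb{D}\to\mathbb{C}$ with $\frac{\partial\phi_t(z)}{\partial t}=F(\phi_t(z))$ for all $z\in\mathbb{D}$, $t\ge0$. $\mathrm{Gen}(\mathbb{D})$ denotes the set of all such generators. Herglotz vector field: a weak holomorphic vector field of order $d\in[1,+\infty]$ on $\mathbb{D}$ is a function $G:\mathbb{D}\times[0,+\infty)\to\mathbb{C}$ such that $t\mapsto G(z,t)$ is measurable for every $z\in\mathbb{D}$, $z\mapsto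 G(z,t)$ is holomorphic for every $t\ge0$, and for every compact $K\subset\mathbb{D}$ and $T>0$ there is a non-negative $k_{K,T}\in L^d([0,T],\mathbb{R})$ with $|G(z,t)|\le k_{K,T}(t)$ for all $z\in K$ and a.e. $t\in[0,T]$. It is a Herglotz vector field (of order $d$) if moreover $G(\cdot,t)\in\mathrm{Gen}(\mathbb{D})$ for almost every $t\in[0,+\infty)$. The positive trajectories of $G$ are $(\varphi_{s,t})$ if for every $(z,s)\in\mathbb{D}\times[0,+\infty)$ the function $x(t)=\varphi_{s,t}(z)$, $t\in[s,+\infty)$, is locally absolutely continuous, $x(s)=z$, and $\dot x(t)=G(x(t),t)$ for a.e. $t\in[s,+\infty)$. *)

theory Defs
  imports "HOL-Analysis.Analysis" "HOL-Probability.Essential_Supremum"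
begin

abbreviation unit_disc :: "complex set"  (\<open>\<D>\<close>) where
  "\<D> \<equiv> ball 0 1"

definition holomorphic_self_map :: "(complex \<Rightarrow> complex) \<Rightarrow> bool" where
  "holomorphic_self_map f \<longleftrightarrow> f holomorphic_on \<D> \<and> f ` \<D> \<subseteq> \<D>"

text \<open>Exponents range over \<^term>\<open>{1..\<infinity>} :: ereal set\<close>.  The elements are functions, not
  classes modulo almost everywhere equality.\<close>

definition L_space :: "ereal \<Rightarrow> 'a measure \<Rightarrow> ('a \<Rightarrow> real) set" where
  "L_space d M = {f \<in> borel_measurable M.
     if d = \<infinity> then esssup M (\<lambda>x. ereal \<bar>f x\<bar>) < \<infinity>
     else integrable M (\<lambda>x. \<bar>f x\<bar> powr real_of_ereal d)}"

text \<open>A family \<open>(\<phi>\<^bsub>s,t\<^esub>)\<close>, \<open>0 \<le> s \<le> t\<close>, is a function \<open>\<phi> s t z\<close> whose values are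
  irrelevant unless \<open>0 \<le> s \<le> t\<close> and \<open>z \<in> \<D>\<close>.\<close>

definition evolution_family :: "ereal \<Rightarrow> (real \<Rightarrow> real \<Rightarrow> complex \<Rightarrow> complex) \<Rightarrow> bool" where
  "evolution_family d \<phi> \<longleftrightarrow>
     (\<forall>s t. 0 \<le> s \<and> s \<le> t \<longrightarrow> holomorphic_self_map (\<phi> s t)) \<and>
     (\<forall>s\<ge>0. \<forall>z\<in>\<D>. \<phi> s s z = z) \<and>
     (\<forall>s u t. 0 \<le> s \<and> s \<le> u \<and> u \<le> t \<longrightarrow> (\<forall>z\<in>\<D>. \<phi> s t z = \<phi> u t (\<phi> s u z))) \<and>
     (\<forall>z\<in>\<D>. \<forall>T>0. \<exists>k \<in> L_space d (lebesgue_on {0..T}).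
        (\<forall>\<xi>\<in>{0..T}. 0 \<le> k \<xi>) \<and>
        (\<forall>s u t. 0 \<le> s \<and> s \<le> u \<and> u \<le> t \<and> t \<le> T \<longrightarrow>
           cmod (\<phi> s u z - \<phi> s t z) \<le> (LINT \<xi>:{u..t}|lebesgue. k \<xi>)))"

definition holomorphic_semigroup :: "(real \<Rightarrow> complex \<Rightarrow> complex) \<Rightarrow> bool" where
  "holomorphic_semigroup \<phi> \<longleftrightarrow>
     (\<forall>t\<ge>0. holomorphic_self_map (\<phi> t)) \<and>
     (\<forall>z\<in>\<D>. \<phi> 0 z = z) \<and>
     (\<forall>s\<ge>0. \<forall>t\<ge>0. \<forall>z\<in>\<D>. \<phi> (t + s) z = \<phi> t (\<phi> s z)) \<and>
     (\<forall>K. compact K \<and> K \<subseteq> \<D> \<longrightarrow> uniform_limit K \<phi> (\<lambda>z. z) (at_right 0))"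

definition infinitesimal_generator ::
  "(real \<Rightarrow> complex \<Rightarrow> complex) \<Rightarrow> (complex \<Rightarrow> complex) \<Rightarrow> bool" where
  "infinitesimal_generator \<phi> F \<longleftrightarrow> F holomorphic_on \<D> \<and>
     (\<forall>z\<in>\<D>. \<forall>t\<ge>0. ((\<lambda>\<tau>. \<phi> \<tau> z) has_vector_derivative F (\<phi> t z)) (at t within {0..}))"

definition Gen :: "(complex \<Rightarrow> complex) set" where
  "Gen = {F. \<exists>\<phi>. holomorphic_semigroup \<phi> \<and> infinitesimal_generator \<phi> F}"

definition weak_holomorphic_vector_field :: "ereal \<Rightarrow> (complex \<Rightarrow> real \<Rightarrow> complex) \<Rightarrow> bool" where
  "weak_holomorphic_vector_field d G \<longleftrightarrow>
     (\<forall>z\<in>\<D>. (\<lambda>t. G z t) \<in> borel_measurable (lebesgue_on {0..})) \<and>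
     (\<forall>t\<ge>0. (\<lambda>z. G z t) holomorphic_on \<D>) \<and>
     (\<forall>K T. compact K \<and> K \<subseteq> \<D> \<and> 0 < T \<longrightarrow>
        (\<exists>k \<in> L_space d (lebesgue_on {0..T}).
           (\<forall>t\<in>{0..T}. 0 \<le> k t) \<and>
           (\<forall>z\<in>K. AE t in lebesgue_on {0..T}. cmod (G z t) \<le> k t)))"

definition herglotz_vector_field :: "ereal \<Rightarrow> (complex \<Rightarrow> real \<Rightarrow> complex) \<Rightarrow> bool" where
  "herglotz_vector_field d G \<longleftrightarrow> weak_holomorphic_vector_field d G \<and>
     (AE t in lebesgue_on {0..}. (\<lambda>z. G z t) \<in> Gen)"

text \<open>Absolute continuity of a function on \<open>[a, b]\<close>; the constant
  \<^const>\<open>absolutely_continuous\<close> of the library is about measures.\<close>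

definition absolutely_continuous_fun :: "real \<Rightarrow> real \<Rightarrow> (real \<Rightarrow> complex) \<Rightarrow> bool" where
  "absolutely_continuous_fun a b x \<longleftrightarrow>
     (\<forall>\<epsilon>>0. \<exists>\<delta>>0. \<forall>(n::nat) l r.
        (\<forall>i<n. a \<le> l i \<and> l i \<le> r i \<and> r i \<le> b) \<and>
        disjoint_family_on (\<lambda>i. {l i<..<r i}) {..<n} \<and>
        (\<Sum>i<n. r i - l i) < \<delta> \<longrightarrow>
        (\<Sum>i<n. cmod (x (r i) - x (l i))) < \<epsilon>)"

definition positive_trajectories ::
  "(complex \<Rightarrow> real \<Rightarrow> complex) \<Rightarrow> (real \<Rightarrow> real \<Rightarrow> complex \<Rightarrow> complex) \<Rightarrow> bool" where
  "positive_trajectories G \<phi> \<longleftrightarrow>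
     (\<forall>z\<in>\<D>. \<forall>s\<ge>0.
        (\<forall>a b. s \<le> a \<and> a \<le> b \<longrightarrow> absolutely_continuous_fun a b (\<lambda>t. \<phi> s t z)) \<and>
        \<phi> s s z = z \<and>
        (AE t in lebesgue_on {s..}.
           ((\<lambda>\<tau>. \<phi> s \<tau> z) has_vector_derivative G (\<phi> s t z) t) (at t within {s..})))"

definition s_quotient ::
  "(real \<Rightarrow> real \<Rightarrow> complex \<Rightarrow> complex) \<Rightarrow> real \<Rightarrow> real \<Rightarrow> complex \<Rightarrow> real \<Rightarrow> complex" where
  "s_quotient \<phi> s t z h = (\<phi> (s + h) t z - \<phi> s t z) / of_real h"

end

theory Submission
  imports Defs "HOL-Complex_Analysis.Conformal_Mappings"
begin

text \<open>
  Both parts rest on a bound for increments in the initial time that is uniform in \<open>z\<close>. For a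
  self-map \<open>f\<close> of the disc, \<open>z - f z + f 0 - cnj (f 0) z\<^sup>2 = z p z\<close> with \<open>Re p \<ge> 0\<close>, so by Harnack's
  inequality \<open>\<bar>f z - z\<bar>\<close> is bounded on every smaller disc by a constant times the sum of its
  values at the two points \<open>0\<close> and \<open>1/2\<close> (\<open>self_map_near_id\<close>). Applied to \<open>f = \<phi> s u\<close>, this yields one
  increasing continuous function \<open>m\<close> on \<open>[0, t]\<close>, the primitive of the sum of two integrable
  majorants, with \<open>\<bar>\<phi> s u z - z\<bar> \<le> C (m u - m s)\<close> for all \<open>\<bar>z\<bar> \<le> r\<close>, where \<open>C\<close> depends only on
  \<open>r\<close>. From \<open>\<phi> s t = \<phi> u t \<circ> \<phi> s u\<close> and Cauchy's estimates the same kind of bound follows for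
  \<open>\<phi> u t z - \<phi> s t z\<close> (\<open>evolution_family_initial_time\<close>).

  Hence \<open>Re (\<phi> s t z) + C m s\<close> and \<open>Im (\<phi> s t z) + C m s\<close> are increasing and continuous in \<open>s\<close>, and
  Lebesgue's theorem on monotone functions (\<open>Lebesgue_mono_differentiable\<close>, proved here by Vitali
  coverings) gives the derivative in \<open>s\<close> for almost every \<open>s\<close>, at first for a single \<open>z\<close>.
  Outside one null set the derivative exists for all \<open>z\<close> in a countable dense set and \<open>m\<close>
  is differentiable; then the difference quotients are locally bounded holomorphic functions of \<open>z\<close>
  converging on a dense set, hence converge locally uniformly to a holomorphic function \<open>L\<close>
  (\<open>locally_bounded_converges_on_dense\<close>). This is the first part.

  For the second part, \<open>\<phi> s t (\<phi> r s z) = \<phi> r t z\<close> does not depend on \<open>s\<close>. Differentiating in \<open>s\<close>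
  along the trajectory \<open>\<phi> r s z\<close>, whose velocity is \<open>G (\<phi> r s z) s\<close>, gives
  \<open>L w + G w s * \<phi>' s t w = 0\<close> at \<open>w = \<phi> r s z\<close>. With \<open>r\<close> rational and \<open>z\<close> in the countable dense
  set this costs only a null set of times, and the points \<open>w\<close> so obtained are dense in the disc
  because \<open>\<phi> r s z\<close> tends to \<open>z\<close> as \<open>r\<close> increases to \<open>s\<close>; by continuity the identity holds on the
  whole disc (\<open>trajectories_quotient_limit\<close>).
\<close>

section \<open>Differentiability of monotone continuous functions\<close>

text \<open>The intervals covering a point are required to contain it in their interior, so that each
  scale contributes an open set and the whole set is a \<open>G\<^sub>\<delta>\<close>.\<close>
definition finely_covered :: "(real \<Rightarrow> real \<Rightarrow> bool) \<Rightarrow> real set" where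
  "finely_covered P = {x. \<forall>e>0. \<exists>c d. c < x \<and> x < d \<and> d - c < e \<and> P c d}"

lemma borel_finely_covered [measurable]: "finely_covered P \<in> sets borel"
proof -
  let ?V = "\<lambda>n::nat. \<Union> {{c<..<d} | c d. d - c < inverse (real (Suc n)) \<and> P c d}"
  have "finely_covered P = (\<Inter>n. ?V n)"
  proof (intro set_eqI iffI)
    fix x assume x: "x \<in> finely_covered P"
    show "x \<in> (\<Inter>n. ?V n)"
    proof
      fix n :: nat
      obtain c d where "c < x" "x < d" "d - c < inverse (real (Suc n))" "P c d"
        using x unfolding finely_covered_def by (force dest: spec[of _ "inverse (real (Suc n))"])
      then show "x \<in> ?V n" by (intro UnionI[of "{c<..<d}"]) auto
    qed
  next
    fix x assume x: "x \<in> (\<Inter>n. ?V n)"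
    show "x \<in> finely_covered P"
      unfolding finely_covered_def
    proof (intro CollectI allI impI)
      fix e :: real assume "e > 0"
      then obtain n where n: "inverse (real (Suc n)) < e" using reals_Archimedean by blast
      have "x \<in> ?V n" using x by blast
      then obtain c d where "x \<in> {c<..<d}" "d - c < inverse (real (Suc n))" "P c d" by blast
      with n show "\<exists>c d. c < x \<and> x < d \<and> d - c < e \<and> P c d"
        by (intro exI[of _ c] exI[of _ d]) auto
    qed
  qed
  moreover have "open (?V n)" for n by (rule open_Union) auto
  ultimately show ?thesis by (simp add: borel_open)
qed

text \<open>Vitali's covering theorem for balls, read on the line, where the closed balls are exactly the
  compact intervals. The ambient open set \<open>U\<close> serves to keep the selected intervals under
  control.\<close>
lemma Vitali_finely_covered:
  assumes "open U" "S \<subseteq> finely_covered P" "S \<subseteq> U"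
  obtains C where "countable C" "\<And>c d. (c, d) \<in> C \<Longrightarrow> c < d \<and> {c..d} \<subseteq> U \<and> P c d"
    "disjoint_family_on (\<lambda>(c, d). {c..d}) C" "negligible (S - (\<Union>(c, d)\<in>C. {c..d}))"
proof -
  define K where "K = {(c, d). c < d \<and> {c..d} \<subseteq> U \<and> P c d}"
  define a where "a = (\<lambda>(c, d). (c + d) / 2 :: real)"
  define r where "r = (\<lambda>(c, d). (d - c) / 2 :: real)"
  have cb: "cball (a i) (r i) = (\<lambda>(c, d). {c..d}) i" for i
    by (cases i) (auto simp: a_def r_def cball_eq_atLeastAtMost field_simps)
  have r: "0 < r i" if "i \<in> K" for i using that by (auto simp: K_def r_def)
  have cov: "\<exists>i. i \<in> K \<and> x \<in> cball (a i) (r i) \<and> r i < e" if x: "x \<in> S" and e: "0 < e" for x e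
  proof -
    obtain \<delta> where \<delta>: "\<delta> > 0" "ball x \<delta> \<subseteq> U"
      using assms x by (meson open_contains_ball subsetD)
    have "min e \<delta> > 0" using e \<delta> by simp
    then obtain c d where cd: "c < x" "x < d" "d - c < min e \<delta>" "P c d"
      using assms(2) x unfolding finely_covered_def by blast
    have "{c..d} \<subseteq> ball x \<delta>" using cd by (auto simp: dist_real_def)
    then have "(c, d) \<in> K" using cd \<delta> by (auto simp: K_def)
    moreover have "r (c, d) < e" using cd by (simp add: r_def)
    moreover have "x \<in> cball (a (c, d)) (r (c, d))" unfolding cb using cd by simp
    ultimately show ?thesis by blast
  qed
  obtain C where C: "countable C" "C \<subseteq> K"
     "pairwise (\<lambda>i j. disjnt (cball (a i) (r i)) (cball (a j) (r j))) C"
     "negligible (S - (\<Union>i \<in> C. cball (a i) (r i)))"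
    by (rule Vitali_covering_theorem_cballs[of K r S a]) (use r cov in blast)+
  show thesis
  proof
    show "countable C" by fact
    show "c < d \<and> {c..d} \<subseteq> U \<and> P c d" if "(c, d) \<in> C" for c d
      using that C(2) by (auto simp: K_def)
    show "disjoint_family_on (\<lambda>(c, d). {c..d}) C"
      using C(3) unfolding cb disjoint_family_on_def pairwise_def disjnt_def by blast
    show "negligible (S - (\<Union>(c, d)\<in>C. {c..d}))"
      using C(4) unfolding cb by simp
  qed
qed

lemma emeasure_le_UN_Icc:
  fixes C :: "(real \<times> real) set"
  assumes "countable C" "disjoint_family_on (\<lambda>(c, d). {c..d}) C"
    "negligible (S - (\<Union>(c, d)\<in>C. {c..d}))" "S \<in> sets lebesgue"
  shows "emeasure lebesgue S \<le> (\<integral>\<^sup>+(c, d). emeasure lebesgue (S \<inter> {c..d}) \<partial>count_space C)"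
proof -
  let ?I = "\<lambda>(c, d). {c..d} :: real set"
  have I: "?I i \<in> sets lebesgue" for i by (cases i) auto
  have U: "(\<Union>i\<in>C. S \<inter> ?I i) \<in> sets lebesgue"
    using assms(1,4) I by (intro sets.countable_UN') auto
  have "S - (\<Union>i\<in>C. ?I i) \<in> null_sets lebesgue"
    using assms(3) by (simp add: negligible_iff_null_sets)
  then have "emeasure lebesgue ((\<Union>i\<in>C. S \<inter> ?I i) \<union> (S - (\<Union>i\<in>C. ?I i))) = emeasure lebesgue (\<Union>i\<in>C. S \<inter> ?I i)"
    using U by (rule emeasure_Un_null_set[rotated])
  also have "(\<Union>i\<in>C. S \<inter> ?I i) \<union> (S - (\<Union>i\<in>C. ?I i)) = S" by blast
  also have "emeasure lebesgue (\<Union>i\<in>C. S \<inter> ?I i) = (\<integral>\<^sup>+i. emeasure lebesgue (S \<inter> ?I i) \<partial>count_space C)"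
    using assms(1,4) I disjoint_family_on_bisimulation[OF assms(2), of "\<lambda>i. S \<inter> ?I i"]
    by (intro emeasure_UN_countable) (blast+)?
  finally show ?thesis by (simp add: case_prod_unfold)
qed

text \<open>One endpoint of a straddling interval may be moved onto \<open>x\<close> itself, by continuity. This is
  what makes it enough to control intervals having \<open>x\<close> in their interior, which in turn is what makes
  the exceptional sets below Borel.\<close>
lemma quotient_le_of_straddling:
  fixes f :: "real \<Rightarrow> real"
  assumes cont: "continuous_on UNIV f" and e: "e > 0"
    and le: "\<And>c d. c < x \<Longrightarrow> x < d \<Longrightarrow> d - c < e \<Longrightarrow> f d - f c \<le> q * (d - c)"
  shows "\<forall>\<^sub>F y in at x. (f y - f x) / (y - x) \<le> q"
proof -
  have ct: "(f \<longlongrightarrow> f x) (at x)"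
    using cont by (simp add: continuous_on_eq_continuous_at isCont_def)
  have "(f y - f x) / (y - x) \<le> q" if y: "y \<noteq> x" "\<bar>y - x\<bar> < e" for y
  proof (cases "y < x")
    case True
    have "f x - f y \<le> q * (x - y)"
    proof (rule tendsto_le[of "at_right x"])
      show "((\<lambda>d. q * (d - y)) \<longlongrightarrow> q * (x - y)) (at_right x)" by (intro tendsto_intros)
      show "((\<lambda>d. f d - f y) \<longlongrightarrow> f x - f y) (at_right x)"
        using ct by (intro tendsto_intros) (auto intro: tendsto_within_subset)
      show "\<forall>\<^sub>F d in at_right x. f d - f y \<le> q * (d - y)"
        unfolding eventually_at_right_field
        using True y by (intro exI[of _ "y + e"]) (auto intro!: le)
    qed auto
    then show ?thesis using True by (simp add: divide_le_eq algebra_simps)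
  next
    case False
    have "f y - f x \<le> q * (y - x)"
    proof (rule tendsto_le[of "at_left x"])
      show "((\<lambda>d. q * (y - d)) \<longlongrightarrow> q * (y - x)) (at_left x)" by (intro tendsto_intros)
      show "((\<lambda>d. f y - f d) \<longlongrightarrow> f y - f x) (at_left x)"
        using ct by (intro tendsto_intros) (auto intro: tendsto_within_subset)
      show "\<forall>\<^sub>F d in at_left x. f y - f d \<le> q * (y - d)"
        unfolding eventually_at_left_field
        using False y by (intro exI[of _ "y - e"]) (auto intro!: le)
    qed auto
    then show ?thesis using False y by (simp add: divide_le_eq algebra_simps)
  qed
  then show ?thesis
    unfolding eventually_at using e by (auto simp: dist_real_def)
qed

context
  fixes g :: "real \<Rightarrow> real"
  assumes mono: "mono g" and cont: "continuous_on UNIV g"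
begin

text \<open>Points near which the mean slope of \<^term>\<open>g\<close> exceeds \<^term>\<open>q\<close>, respectively falls below
  \<^term>\<open>p\<close>, on arbitrarily short intervals. Where the upper and lower derivatives of \<^term>\<open>g\<close> differ,
  a point lies in both sets for suitable rationals \<open>p < q\<close>.\<close>
definition upper_set :: "real \<Rightarrow> real set" where
  "upper_set q = finely_covered (\<lambda>c d. q * (d - c) < g d - g c)"

definition lower_set :: "real \<Rightarrow> real set" where
  "lower_set p = finely_covered (\<lambda>c d. g d - g c < p * (d - c))"

text \<open>Disjoint intervals in \<open>{a..b}\<close> cannot use up more than the total increment: their increments
  are their masses for the Stieltjes measure of \<^term>\<open>g\<close>.\<close>
lemma sum_increments:
  assumes "countable C" "disjoint_family_on (\<lambda>(c, d). {c..d}) C"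
    and "\<And>c d. (c, d) \<in> C \<Longrightarrow> c < d \<and> {c..d} \<subseteq> {a..b}" and "a \<le> b"
  shows "(\<integral>\<^sup>+(c, d). ennreal (g d - g c) \<partial>count_space C) \<le> ennreal (g b - g a)"
proof -
  let ?I = "\<lambda>(c, d). {c..d} :: real set"
  let ?\<nu> = "interval_measure g"
  have I: "?I i \<in> sets borel" for i by (cases i) auto
  have \<nu>: "emeasure ?\<nu> {c..d} = ennreal (g d - g c)" if "c \<le> d" for c d
    using that mono cont by (intro emeasure_interval_measure_Icc) (auto simp: mono_def)
  have "(\<integral>\<^sup>+(c, d). ennreal (g d - g c) \<partial>count_space C) = (\<integral>\<^sup>+i. emeasure ?\<nu> (?I i) \<partial>count_space C)"
    using assms(3) by (intro nn_integral_cong) (auto simp: \<nu> less_imp_le)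
  also have "\<dots> = emeasure ?\<nu> (\<Union>i\<in>C. ?I i)"
    using assms I by (intro emeasure_UN_countable[symmetric]) auto
  also have "\<dots> \<le> emeasure ?\<nu> {a..b}"
    using assms(3) by (intro emeasure_mono) (blast, simp)
  finally show ?thesis using \<nu> assms(4) by simp
qed

text \<open>Almost all of \<open>S\<close> is covered by disjoint intervals of slope larger than \<^term>\<open>q\<close>, whose
  total length is at most the sum of their increments divided by \<^term>\<open>q\<close>.\<close>
lemma emeasure_upper_set:
  assumes "S \<in> sets lebesgue" "S \<subseteq> upper_set q" "S \<subseteq> {a<..<b}" "0 \<le> q" "a \<le> b"
  shows "ennreal q * emeasure lebesgue S \<le> ennreal (g b - g a)"
proof -
  obtain C where C: "countable C"
      "\<And>c d. (c, d) \<in> C \<Longrightarrow> c < d \<and> {c..d} \<subseteq> {a<..<b} \<and> q * (d - c) < g d - g c"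
      "disjoint_family_on (\<lambda>(c, d). {c..d}) C" "negligible (S - (\<Union>(c, d)\<in>C. {c..d}))"
    by (rule Vitali_finely_covered[OF open_greaterThanLessThan assms(2)[unfolded upper_set_def] assms(3)]) blast
  have "ennreal q * emeasure lebesgue S
      \<le> ennreal q * (\<integral>\<^sup>+(c, d). emeasure lebesgue (S \<inter> {c..d}) \<partial>count_space C)"
    by (intro mult_left_mono emeasure_le_UN_Icc C assms) simp
  also have "\<dots> = (\<integral>\<^sup>+i. ennreal q * (\<lambda>(c, d). emeasure lebesgue (S \<inter> {c..d})) i \<partial>count_space C)"
    by (rule nn_integral_cmult[symmetric]) simp
  also have "\<dots> \<le> (\<integral>\<^sup>+(c, d). ennreal (g d - g c) \<partial>count_space C)"
  proof (intro nn_integral_mono)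
    fix i assume "i \<in> space (count_space C)"
    then obtain c d where i: "i = (c, d)" "(c, d) \<in> C" by (cases i) auto
    have "ennreal q * emeasure lebesgue (S \<inter> {c..d}) \<le> ennreal q * emeasure lebesgue {c..d}"
      by (intro mult_left_mono emeasure_mono) auto
    also have "\<dots> = ennreal (q * (d - c))"
      using C(2)[OF i(2)] assms by (simp add: ennreal_mult)
    also have "\<dots> \<le> ennreal (g d - g c)"
      using C(2)[OF i(2)] by (intro ennreal_leI) auto
    finally show "ennreal q * (\<lambda>(c, d). emeasure lebesgue (S \<inter> {c..d})) i \<le> (\<lambda>(c, d). ennreal (g d - g c)) i"
      using i by simp
  qed
  also have "\<dots> \<le> ennreal (g b - g a)"
  proof (rule sum_increments[OF C(1,3) _ assms(5)])
    fix c d assume "(c, d) \<in> C"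
    from C(2)[OF this] show "c < d \<and> {c..d} \<subseteq> {a..b}" by (auto simp: subset_eq)
  qed
  finally show ?thesis .
qed

text \<open>The set \<open>E\<close> is covered twice. Intervals of slope below \<^term>\<open>p\<close>, chosen inside an open set of
  measure at most \<open>\<mu> E + e\<close>, have total increment at most \<open>p (\<mu> E + e)\<close>; inside each of them
  \<open>emeasure_upper_set\<close> bounds the measure of the part of \<open>E\<close>. Together
  \<open>q \<mu> E \<le> p (\<mu> E + e)\<close> for every \<open>e > 0\<close>, which forces \<open>\<mu> E = 0\<close>.\<close>
lemma null_upper_Int_lower:
  assumes "0 < p" "p < q"
  shows "upper_set q \<inter> lower_set p \<inter> {a<..<b} \<in> null_sets lebesgue"
proof -
  let ?E = "upper_set q \<inter> lower_set p \<inter> {a<..<b}"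
  let ?\<mu> = "emeasure lebesgue"
  have E: "?E \<in> sets borel" by (auto simp: upper_set_def lower_set_def)
  then have E': "?E \<in> sets lebesgue" by (simp add: sets_completionI_sets)
  have fin: "?\<mu> ?E < \<infinity>"
  proof -
    have "?\<mu> ?E \<le> ?\<mu> {a<..<b}" by (intro emeasure_mono) auto
    also have "\<dots> < \<infinity>" by (cases "a \<le> b") (auto simp: ennreal_less_top)
    finally show ?thesis .
  qed
  have key: "ennreal q * ?\<mu> ?E \<le> ennreal p * (?\<mu> ?E + ennreal e)" if e: "e > 0" for e
  proof -
    obtain T where T: "open T" "?E \<subseteq> T" "T - ?E \<in> lmeasurable" "?\<mu> (T - ?E) < ennreal e"
      using E' e by (rule sets_lebesgue_outer_open)
    obtain C where C: "countable C"
        "\<And>c d. (c, d) \<in> C \<Longrightarrow> c < d \<and> {c..d} \<subseteq> T \<and> g d - g c < p * (d - c)"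
        "disjoint_family_on (\<lambda>(c, d). {c..d}) C" "negligible (?E - (\<Union>(c, d)\<in>C. {c..d}))"
      by (rule Vitali_finely_covered[OF T(1), of ?E "\<lambda>c d. g d - g c < p * (d - c)"])
        (use T(2) in \<open>auto simp: lower_set_def\<close>)
    have "ennreal q * ?\<mu> ?E \<le> ennreal q * (\<integral>\<^sup>+(c, d). ?\<mu> (?E \<inter> {c..d}) \<partial>count_space C)"
      by (intro mult_left_mono emeasure_le_UN_Icc C E') simp
    also have "\<dots> = (\<integral>\<^sup>+i. ennreal q * (\<lambda>(c, d). ?\<mu> (?E \<inter> {c..d})) i \<partial>count_space C)"
      by (rule nn_integral_cmult[symmetric]) simp
    also have "\<dots> \<le> (\<integral>\<^sup>+i. ennreal p * (\<lambda>(c, d). ?\<mu> {c..d}) i \<partial>count_space C)"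
    proof (intro nn_integral_mono)
      fix i assume "i \<in> space (count_space C)"
      then obtain c d where i: "i = (c, d)" "(c, d) \<in> C" by (cases i) auto
      note cd = C(2)[OF i(2)]
      \<comment> \<open>the bound on the upper set needs a set inside an open interval; two endpoints are lost\<close>
      have "?E \<inter> {c..d} = (?E \<inter> {c<..<d}) \<union> (?E \<inter> {c, d})" using cd by auto
      moreover have "?\<mu> ((?E \<inter> {c<..<d}) \<union> (?E \<inter> {c, d})) = ?\<mu> (?E \<inter> {c<..<d})"
      proof (rule emeasure_Un_null_set)
        show "?E \<inter> {c<..<d} \<in> sets lebesgue" using E' by auto
        have "finite (?E \<inter> {c, d})" by simp
        then have "negligible (?E \<inter> {c, d})" by (rule negligible_finite)
        then show "?E \<inter> {c, d} \<in> null_sets lebesgue" by (simp add: negligible_iff_null_sets)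
      qed
      moreover have "ennreal q * ?\<mu> (?E \<inter> {c<..<d}) \<le> ennreal (g d - g c)"
        using E' cd assms by (intro emeasure_upper_set) auto
      moreover have "ennreal (g d - g c) \<le> ennreal p * ?\<mu> {c..d}"
        using cd assms by (auto simp: ennreal_mult'[symmetric] intro!: ennreal_leI)
      ultimately show "ennreal q * (\<lambda>(c, d). ?\<mu> (?E \<inter> {c..d})) i \<le> ennreal p * (\<lambda>(c, d). ?\<mu> {c..d}) i"
        using i by simp
    qed
    also have "\<dots> = ennreal p * (\<integral>\<^sup>+i. (\<lambda>(c, d). ?\<mu> {c..d}) i \<partial>count_space C)"
      by (rule nn_integral_cmult) simp
    also have "(\<integral>\<^sup>+i. (\<lambda>(c, d). ?\<mu> {c..d}) i \<partial>count_space C) = ?\<mu> (\<Union>i\<in>C. (\<lambda>(c, d). {c..d}) i)"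
      using C by (subst emeasure_UN_countable) (auto simp: case_prod_unfold)
    also have "ennreal p * \<dots> \<le> ennreal p * ?\<mu> T"
    proof (intro mult_left_mono emeasure_mono)
      show "(\<Union>i\<in>C. (\<lambda>(c, d). {c..d}) i) \<subseteq> T" using C(2) by blast
    qed (use T(1) in auto)
    also have "?\<mu> T = ?\<mu> (?E \<union> (T - ?E))" using T(2) by (simp add: Un_absorb1)
    also have "\<dots> \<le> ?\<mu> ?E + ?\<mu> (T - ?E)"
      using E' T by (intro emeasure_subadditive) auto
    also have "\<dots> \<le> ?\<mu> ?E + ennreal e" using T by (intro add_left_mono) auto
    finally show ?thesis by (simp add: mult_left_mono)
  qed
  obtain m where m: "?\<mu> ?E = ennreal m" "m \<ge> 0" using fin by (cases "?\<mu> ?E") auto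
  have "q * m \<le> p * (m + e)" if "e > 0" for e
    using key[OF that] that m assms by (simp flip: ennreal_mult ennreal_plus)
  from this[of "e / p" for e] have "q * m \<le> p * m + e" if "e > 0" for e
    using that assms by (simp add: distrib_left)
  then have "q * m \<le> p * m" by (rule field_le_epsilon)
  then have "m = 0" using assms m by (smt (verit) mult_less_cancel_right)
  then show ?thesis using E' m by auto
qed

text \<open>The points where the upper derivative is infinite: by \<open>emeasure_upper_set\<close> the measure is at
  most \<open>(g b - g a) / n\<close> for every \<open>n\<close>.\<close>
lemma null_Inter_upper: "(\<Inter>n::nat. upper_set (real n)) \<inter> {a<..<b} \<in> null_sets lebesgue"
proof (cases "a \<le> b")
  case True
  let ?E = "(\<Inter>n::nat. upper_set (real n)) \<inter> {a<..<b}"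
  have "?E \<in> sets borel" by (auto simp: upper_set_def)
  then have E': "?E \<in> sets lebesgue" by (simp add: sets_completionI_sets)
  have le: "ennreal (real n) * emeasure lebesgue ?E \<le> ennreal (g b - g a)" for n :: nat
    using E' True by (intro emeasure_upper_set) auto
  have "emeasure lebesgue ?E = 0"
  proof (rule ccontr)
    assume nz: "emeasure lebesgue ?E \<noteq> 0"
    obtain m where m: "emeasure lebesgue ?E = ennreal m" "m > 0"
    proof (cases "emeasure lebesgue ?E")
      case top then show thesis using le[of 1] by (simp add: top_unique)
    next
      case (real r) then show thesis using nz that by (cases "r = 0") auto
    qed
    obtain n where n: "real n * m > g b - g a" using m(2) by (meson ex_less_of_nat_mult)
    have "0 \<le> g b - g a" using mono True by (simp add: mono_def)
    then have "real n * m \<le> g b - g a"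
      using le[of n] m by (simp flip: ennreal_mult)
    with n show False by simp
  qed
  then show ?thesis using E' by auto
qed auto

lemma quotient_le_of_not_upper:
  assumes "x \<notin> upper_set q"
  shows "\<forall>\<^sub>F y in at x. (g y - g x) / (y - x) \<le> q"
proof -
  obtain e where "e > 0" "\<And>c d. c < x \<Longrightarrow> x < d \<Longrightarrow> d - c < e \<Longrightarrow> g d - g c \<le> q * (d - c)"
    using assms unfolding upper_set_def finely_covered_def by (simp add: not_less) (metis linorder_not_le)
  then show ?thesis using cont by (intro quotient_le_of_straddling) auto
qed

lemma quotient_ge_of_not_lower:
  assumes "x \<notin> lower_set p"
  shows "\<forall>\<^sub>F y in at x. p \<le> (g y - g x) / (y - x)"
proof -
  obtain e where e: "e > 0" "\<And>c d. c < x \<Longrightarrow> x < d \<Longrightarrow> d - c < e \<Longrightarrow> p * (d - c) \<le> g d - g c"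
    using assms unfolding lower_set_def finely_covered_def by (simp add: not_less) (metis linorder_not_le)
  have "- g d - - g c \<le> - p * (d - c)" if "c < x" "x < d" "d - c < e" for c d
    using e(2)[OF that] by simp
  then have "\<forall>\<^sub>F y in at x. (- g y - - g x) / (y - x) \<le> - p"
    using cont e(1) by (intro quotient_le_of_straddling continuous_on_minus) auto
  then show ?thesis
  proof eventually_elim
    case (elim y)
    have "(- g y - - g x) / (y - x) = - ((g y - g x) / (y - x))"
      by (simp add: minus_divide_left)
    with elim show ?case by linarith
  qed
qed

text \<open>The derivative is the infimum of all eventual upper bounds of the difference quotient; a gap
  between the upper and the lower derivative would contain two positive rationals.\<close>
lemma mono_differentiable_off:
  assumes fin: "x \<notin> upper_set (real n)"
    and gap: "\<And>p q. p \<in> \<rat> \<Longrightarrow> q \<in> \<rat> \<Longrightarrow> 0 < p \<Longrightarrow> p < q \<Longrightarrow> x \<notin> upper_set q \<inter> lower_set p"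
  shows "\<exists>D. (g has_real_derivative D) (at x)"
proof -
  let ?Q = "\<lambda>y. (g y - g x) / (y - x)"
  define A where "A = {q. \<forall>\<^sub>F y in at x. ?Q y \<le> q}"
  have nn: "0 \<le> ?Q y" for y
    using monoD[OF mono, of x y] monoD[OF mono, of y x] by (cases "x \<le> y") (auto simp: zero_le_divide_iff)
  have A0: "0 \<le> q" if "q \<in> A" for q
  proof -
    have "\<forall>\<^sub>F y in at x. ?Q y \<le> q" using that by (simp add: A_def)
    then obtain y where "?Q y \<le> q" using eventually_happens' trivial_limit_at by blast
    with nn[of y] show ?thesis by linarith
  qed
  have ne: "A \<noteq> {}" using quotient_le_of_not_upper[OF fin] by (auto simp: A_def)
  have bdd: "bdd_below A" using A0 by (rule bdd_belowI)
  have "(?Q \<longlongrightarrow> Inf A) (at x)"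
  proof (rule order_tendstoI)
    fix y assume "Inf A < y"
    then obtain q where "q \<in> A" "q < y" using cInf_lessD ne by blast
    then show "\<forall>\<^sub>F u in at x. ?Q u < y"
      by (auto simp: A_def elim: eventually_mono)
  next
    fix y assume y: "y < Inf A"
    show "\<forall>\<^sub>F u in at x. y < ?Q u"
    proof (cases "y < 0")
      case True
      with nn show ?thesis by (intro always_eventually) (auto intro: less_le_trans)
    next
      case False
      obtain p where p: "p \<in> \<rat>" "y < p" "p < Inf A" using Rats_dense_in_real y by blast
      obtain q where q: "q \<in> \<rat>" "p < q" "q < Inf A" using Rats_dense_in_real p by blast
      have "q \<notin> A" using q(3) bdd by (meson cInf_lower not_less)
      then have "x \<in> upper_set q" using quotient_le_of_not_upper by (auto simp: A_def)
      then have "x \<notin> lower_set p" using gap[of p q] p q False by auto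
      then have "\<forall>\<^sub>F u in at x. p \<le> ?Q u" by (rule quotient_ge_of_not_lower)
      then show ?thesis using p(2) by (auto elim: eventually_mono)
    qed
  qed
  then show ?thesis by (auto simp: has_field_derivative_iff)
qed

text \<open>Lebesgue's differentiation theorem for monotone functions, in the continuous case.\<close>
lemma Lebesgue_mono_differentiable:
  "\<exists>N \<in> null_sets lebesgue. \<forall>x. x \<notin> N \<longrightarrow> (\<exists>D. (g has_real_derivative D) (at x))"
proof -
  define N where "N = (\<Union>k::nat. (\<Inter>n::nat. upper_set (real n)) \<inter> {- real k<..<real k})
     \<union> (\<Union>k::nat. \<Union>(p, q)\<in>{(p, q). p \<in> \<rat> \<and> q \<in> \<rat> \<and> 0 < p \<and> p < q}.
          upper_set q \<inter> lower_set p \<inter> {- real k<..<real k})"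
  have cnt: "countable {(p, q). p \<in> \<rat> \<and> q \<in> \<rat> \<and> 0 < p \<and> p < (q::real)}"
    by (rule countable_subset[of _ "\<rat> \<times> \<rat>"]) (auto intro: countable_rat)
  have "N \<in> null_sets lebesgue"
    unfolding N_def
    by (intro null_sets.Un null_sets_UN' null_Inter_upper cnt countableI_type)
      (auto intro: null_upper_Int_lower)
  moreover have "\<exists>D. (g has_real_derivative D) (at x)" if x: "x \<notin> N" for x
  proof -
    obtain k :: nat where k: "\<bar>x\<bar> < real k" using reals_Archimedean2 by blast
    then have xk: "x \<in> {- real k<..<real k}" by auto
    have "x \<notin> (\<Inter>n::nat. upper_set (real n))" using x xk unfolding N_def by blast
    then obtain n :: nat where "x \<notin> upper_set (real n)" by blast
    moreover have "x \<notin> upper_set q \<inter> lower_set p" if "p \<in> \<rat>" "q \<in> \<rat>" "0 < p" "p < q" for p q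
      using x xk that unfolding N_def by blast
    ultimately show ?thesis by (rule mono_differentiable_off)
  qed
  ultimately show ?thesis by blast
qed

end

section \<open>Holomorphic functions on the disc\<close>

text \<open>The Cayley-type transform \<open>w \<mapsto> (w - p 0) / (w + cnj (p 0))\<close> maps the right half-plane into
  the disc and \<open>p 0\<close> to \<open>0\<close>, so Schwarz's lemma applies to its composition with \<open>p\<close>. The shift by \<open>e > 0\<close> keeps the denominator away
  from \<open>0\<close> when \<open>Re (p 0) = 0\<close>.\<close>
lemma Re_nonneg_Schwarz:
  assumes hol: "p holomorphic_on ball 0 1"
    and Re: "\<And>z. cmod z < 1 \<Longrightarrow> 0 \<le> Re (p z)"
    and z: "cmod z < 1"
  shows "cmod (p z - p 0) \<le> cmod z * cmod (p z + cnj (p 0))"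
proof -
  have "cmod (p z - p 0) \<le> cmod z * cmod (p z + cnj (p 0) + of_real (2 * e))" if e: "e > 0" for e
  proof -
    define q where "q w = (p w - p 0) / (p w + cnj (p 0) + of_real (2 * e))" for w
    have pos: "0 < Re (p w + cnj (p 0) + of_real (2 * e))" if "cmod w < 1" for w
      using Re[OF that] Re[of 0] e by simp
    then have nz: "p w + cnj (p 0) + of_real (2 * e) \<noteq> 0" if "cmod w < 1" for w
      using that by (metis less_irrefl zero_complex.sel(1))
    have "cmod (q w) < 1" if w: "cmod w < 1" for w
    proof -
      let ?a = "p w + of_real e" and ?b = "p 0 + of_real e"
      have "0 < Re ?a * Re ?b" using Re[OF w] Re[of 0] e by (intro mult_pos_pos) auto
      then have "(cmod (?a - ?b))\<^sup>2 < (cmod (?a + cnj ?b))\<^sup>2"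
        unfolding cmod_power2 by (simp add: power2_eq_square algebra_simps)
      then have "cmod (?a - ?b) < cmod (?a + cnj ?b)" by (rule power2_less_imp_less) simp
      then have "cmod (p w - p 0) < cmod (p w + cnj (p 0) + of_real (2 * e))"
        by (simp add: algebra_simps)
      then show ?thesis using nz[OF w] by (simp add: q_def norm_divide)
    qed
    moreover have "q holomorphic_on ball 0 1"
      unfolding q_def using hol nz by (intro holomorphic_intros) auto
    ultimately have "cmod (q z) \<le> cmod z"
      using z by (intro Schwarz_Lemma(1)) (simp_all, simp add: q_def)
    then show ?thesis using nz[OF z] by (simp add: q_def norm_divide divide_le_eq)
  qed
  then have "\<forall>\<^sub>F e in at_right 0. cmod (p z - p 0) \<le> cmod z * cmod (p z + cnj (p 0) + of_real (2 * e))"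
    by (auto simp: eventually_at_right_field intro: exI[of _ 1])
  moreover have "((\<lambda>e. cmod z * cmod (p z + cnj (p 0) + of_real (2 * e))) \<longlongrightarrow>
      cmod z * cmod (p z + cnj (p 0) + of_real (2 * 0))) (at_right 0)"
    by (intro tendsto_intros)
  ultimately show ?thesis
    by (intro tendsto_lowerbound[where F = "at_right (0::real)"]) auto
qed

text \<open>Harnack inequalities in both directions between \<open>0\<close> and \<open>z\<close>: they let the value of \<open>p\<close> at one
  point control its values on every smaller disc.\<close>
lemma Harnack_at_centre:
  assumes "p holomorphic_on ball 0 1" "\<And>z. cmod z < 1 \<Longrightarrow> 0 \<le> Re (p z)" "cmod z \<le> r" "r < 1"
  shows "cmod (p z - p 0) \<le> 2 / (1 - r) * cmod (p 0)"
    and "cmod (p z - p 0) \<le> 2 * r / (1 - r) * cmod (p z)"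
proof -
  have r0: "0 \<le> r" using assms(3) norm_ge_zero order_trans by blast
  have S: "cmod (p z - p 0) \<le> r * cmod (p z + cnj (p 0))"
    using Re_nonneg_Schwarz[OF assms(1,2), of z] assms(3,4)
    by (meson le_less_trans mult_right_mono norm_ge_zero order_trans)
  have e1: "p z + cnj (p 0) = (p z - p 0) + 2 * of_real (Re (p 0))"
    and e2: "p z + cnj (p 0) = 2 * of_real (Re (p z)) - cnj (p z - p 0)"
    by (simp_all add: complex_eq_iff)
  have "cmod (p z + cnj (p 0)) \<le> cmod (p z - p 0) + 2 * cmod (p 0)"
    unfolding e1 by (rule norm_triangle_le) (use abs_Re_le_cmod[of "p 0"] in \<open>simp add: norm_mult\<close>)
  then have "cmod (p z - p 0) \<le> r * (cmod (p z - p 0) + 2 * cmod (p 0))"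
    using S r0 by (meson mult_left_mono order_trans)
  then have "(1 - r) * cmod (p z - p 0) \<le> r * (2 * cmod (p 0))" by (simp add: algebra_simps)
  also have "\<dots> \<le> 1 * (2 * cmod (p 0))" using assms(4) by (intro mult_right_mono) auto
  finally show "cmod (p z - p 0) \<le> 2 / (1 - r) * cmod (p 0)"
    using assms(4) by (simp add: field_simps)
  have "cmod (p z + cnj (p 0)) \<le> 2 * cmod (p z) + cmod (p z - p 0)"
    unfolding e2 by (rule norm_triangle_le_diff)
      (use abs_Re_le_cmod[of "p z"] in \<open>simp add: norm_mult flip: complex_cnj_diff\<close>)
  then have "cmod (p z - p 0) \<le> r * (2 * cmod (p z) + cmod (p z - p 0))"
    using S r0 by (meson mult_left_mono order_trans)
  then show "cmod (p z - p 0) \<le> 2 * r / (1 - r) * cmod (p z)"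
    using assms(4) by (simp add: field_simps)
qed

text \<open>The displacement \<open>z - f z\<close> of a self-map has the form found by Berkson and Porta for
  infinitesimal generators, up to sign. On the unit circle the real part of \<open>p z\<close> would be
  \<open>1 - Re (cnj z * f z) \<ge> 0\<close>, the two terms with \<open>f 0\<close> contributing a purely imaginary number. As
  \<open>f\<close> has no boundary values in general, the circle is approached by circles of radius \<open>R < 1\<close>, on
  which the error \<open>B R\<close> tends to \<open>0\<close>, and the maximum principle is applied on each.\<close>
lemma self_map_Berkson_Porta:
  assumes hol: "f holomorphic_on ball 0 1" and self: "f ` ball 0 1 \<subseteq> ball 0 1"
  obtains p where "p holomorphic_on ball 0 1" "\<And>z. cmod z < 1 \<Longrightarrow> 0 \<le> Re (p z)"
    "\<And>z. cmod z < 1 \<Longrightarrow> z - f z + f 0 - cnj (f 0) * z\<^sup>2 = z * p z"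
proof -
  let ?h = "\<lambda>z. z - f z + f 0 - cnj (f 0) * z\<^sup>2"
  have f1: "cmod (f z) < 1" if "cmod z < 1" for z using self that by (auto simp: image_subset_iff)
  have "?h holomorphic_on ball 0 1" by (intro holomorphic_intros hol)
  then obtain p where p: "p holomorphic_on ball 0 1" "\<And>z. cmod z < 1 \<Longrightarrow> ?h z = z * p z"
    by (rule Schwarz3) auto
  have "0 \<le> Re (p z)" if z: "cmod z < 1" for z
  proof -
    define B where "B R = (1 / R - 1) + R * (1 / R\<^sup>2 - 1)" for R :: real
    have bound: "Re (- p z) \<le> B R" if R: "cmod z < R" "R < 1" for R
    proof -
      have R0: "R > 0" using R(1) norm_ge_zero le_less_trans by blast
      show ?thesis
      proof (rule maximum_real_frontier[of "\<lambda>z. - p z" "cball 0 R"])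
        have sub: "cball 0 R \<subseteq> ball (0::complex) 1" using R by auto
        show "(\<lambda>z. - p z) holomorphic_on interior (cball 0 R)"
          using p(1) sub by (intro holomorphic_intros holomorphic_on_subset[OF p(1)]) auto
        show "continuous_on (closure (cball 0 R)) (\<lambda>z. - p z)"
          using holomorphic_on_imp_continuous_on[OF p(1)] sub
          by (auto intro!: continuous_intros intro: continuous_on_subset)
        show "Re (- p w) \<le> B R" if "w \<in> frontier (cball 0 R)" for w
        proof -
          have w: "cmod w = R" using that R0 by simp
          then have w0: "w \<noteq> 0" "cmod w < 1" using R0 R by auto
          have ww: "w * cnj w = of_real (R\<^sup>2)" using complex_norm_square[of w] w by simp
          have "p w = ?h w / w" using p(2)[OF w0(2)] w0(1) by (simp add: field_simps)
          also have "\<dots> = ?h w * cnj w / of_real (R\<^sup>2)"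
            using w0 R0 unfolding ww[symmetric] by simp
          also have "?h w * cnj w = of_real (R\<^sup>2) - f w * cnj w + f 0 * cnj w - cnj (f 0) * (w * of_real (R\<^sup>2))"
            unfolding ww[symmetric] by (simp add: algebra_simps power2_eq_square)
          also have "\<dots> / of_real (R\<^sup>2) = 1 - (f w * cnj w) / of_real (R\<^sup>2)
              + (f 0 * cnj w) / of_real (R\<^sup>2) - cnj (f 0) * w"
            using R0 by (simp add: field_simps)
          finally have pw: "p w = 1 - (f w * cnj w) / of_real (R\<^sup>2)
              + (f 0 * cnj w) / of_real (R\<^sup>2) - cnj (f 0) * w" .
          have "Re (- p w) = Re (f w * cnj w) / R\<^sup>2 - Re (f 0 * cnj w) * (1 / R\<^sup>2 - 1) - 1"
            by (subst pw) (simp add: algebra_simps add_divide_distrib del: of_real_power)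
          moreover have "Re (f w * cnj w) / R\<^sup>2 \<le> R / R\<^sup>2"
          proof (intro divide_right_mono)
            have "Re (f w * cnj w) \<le> cmod (f w) * R"
              using complex_Re_le_cmod[of "f w * cnj w"] w by (simp add: norm_mult)
            also have "\<dots> \<le> 1 * R" using f1[OF w0(2)] R0 by (intro mult_right_mono) auto
            finally show "Re (f w * cnj w) \<le> R" by simp
          qed simp
          moreover have "- Re (f 0 * cnj w) * (1 / R\<^sup>2 - 1) \<le> R * (1 / R\<^sup>2 - 1)"
          proof (intro mult_right_mono)
            have "- Re (f 0 * cnj w) \<le> cmod (f 0) * R"
              using abs_Re_le_cmod[of "f 0 * cnj w"] w by (simp add: norm_mult)
            also have "\<dots> \<le> 1 * R" using f1[of 0] R0 by (intro mult_right_mono) auto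
            finally show "- Re (f 0 * cnj w) \<le> R" by simp
            have "R\<^sup>2 \<le> 1" using R R0 by (simp add: power_le_one)
            then show "0 \<le> 1 / R\<^sup>2 - 1" using R0 by (simp add: field_simps)
          qed
          moreover have "R / R\<^sup>2 = 1 / R" using R0 by (simp add: power2_eq_square)
          ultimately show ?thesis unfolding B_def by linarith
        qed
      qed (use R in auto)
    qed
    have "\<forall>\<^sub>F R in at_left 1. Re (- p z) \<le> B R"
      unfolding eventually_at_left_field using z bound by (intro exI[of _ "cmod z"]) auto
    moreover have "(B \<longlongrightarrow> (1 / 1 - 1) + 1 * (1 / 1\<^sup>2 - 1)) (at_left 1)"
      unfolding B_def by (intro tendsto_intros) auto
    ultimately have "Re (- p z) \<le> (1 / 1 - 1) + 1 * (1 / 1\<^sup>2 - 1)"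
      by (intro tendsto_lowerbound[where F = "at_left (1::real)"]) auto
    then show ?thesis by simp
  qed
  with p show thesis using that by blast
qed

text \<open>Displacements at the two points \<open>0\<close> and \<open>1/2\<close> bound the displacement on every compact subset,
  linearly and uniformly over all self-maps. The displacement at \<open>0\<close> alone would not do, as rotations
  show; the second point controls the function \<open>p\<close> of \<open>self_map_Berkson_Porta\<close>, and
  Harnack's inequality carries that bound from \<open>1/2\<close> through \<open>0\<close> to \<open>z\<close>.\<close>
lemma self_map_near_id:
  assumes hol: "f holomorphic_on ball 0 1" and self: "f ` ball 0 1 \<subseteq> ball 0 1"
    and z: "cmod z \<le> r" "r < 1"
  shows "cmod (f z - z) \<le> (14 + 24 / (1 - r)) * (cmod (f 0) + cmod (f (1/2) - 1/2))"
proof -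
  obtain p where p: "p holomorphic_on ball 0 1" "\<And>z. cmod z < 1 \<Longrightarrow> 0 \<le> Re (p z)"
    "\<And>z. cmod z < 1 \<Longrightarrow> z - f z + f 0 - cnj (f 0) * z\<^sup>2 = z * p z"
    using self_map_Berkson_Porta[OF hol self] by metis
  define A where "A = cmod (f 0)"
  define D where "D = cmod (f (1/2) - 1/2)"
  have A0: "A \<ge> 0" "D \<ge> 0" by (simp_all add: A_def D_def)
  have z1: "cmod z < 1" using z by simp
  have half: "cmod (p (1/2)) \<le> 2 * D + 4 * A"
  proof -
    have "1/2 * p (1/2) = (1/2 - f (1/2)) + (f 0 - cnj (f 0) * (1/2)\<^sup>2)"
      using p(3)[of "1/2"] by (simp add: diff_divide_distrib) (simp add: algebra_simps)
    then have "cmod (1/2 * p (1/2)) \<le> cmod (1/2 - f (1/2)) + cmod (f 0 - cnj (f 0) * (1/2)\<^sup>2)"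
      using norm_triangle_ineq by metis
    also have "cmod (f 0 - cnj (f 0) * (1/2)\<^sup>2) \<le> A + A * (1/4)"
      using norm_triangle_ineq4[of "f 0" "cnj (f 0) * (1/2)\<^sup>2"] by (simp add: norm_mult A_def power2_eq_square)
    finally show ?thesis using A0 by (simp add: norm_mult D_def norm_minus_commute)
  qed
  \<comment> \<open>Harnack's inequality from \<open>1/2\<close> to \<open>0\<close>, where the constant is \<open>2\<close>, and from \<open>0\<close> to \<open>z\<close>\<close>
  have "cmod (p (1/2) - p 0) \<le> 2 * (1/2) / (1 - 1/2) * cmod (p (1/2))"
    using p(1,2) by (intro Harnack_at_centre(2)) auto
  then have p0: "cmod (p 0) \<le> 3 * cmod (p (1/2))"
    using norm_triangle_sub[of "p 0" "p (1/2)"] by (simp add: norm_minus_commute)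
  have pz: "cmod (p z) \<le> (1 + 2 / (1 - r)) * cmod (p 0)"
    using Harnack_at_centre(1)[OF p(1,2) z] norm_triangle_sub[of "p z" "p 0"] by (simp add: algebra_simps)
  have "f z - z = (f 0 - cnj (f 0) * z\<^sup>2) - z * p z"
    using p(3)[OF z1] by (simp add: algebra_simps)
  then have "cmod (f z - z) \<le> cmod (f 0) + cmod (cnj (f 0) * z\<^sup>2) + cmod (z * p z)"
    by (metis add_mono_thms_linordered_semiring(3) norm_triangle_ineq4 order_trans)
  also have "cmod (cnj (f 0) * z\<^sup>2) \<le> A * 1"
    unfolding norm_mult norm_power complex_mod_cnj A_def
    using z1 by (intro mult_left_mono power_le_one) auto
  also have "cmod (z * p z) \<le> 1 * cmod (p z)"
    unfolding norm_mult using z1 by (intro mult_right_mono) auto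
  finally have fz: "cmod (f z - z) \<le> 2 * A + cmod (p z)" by (simp add: A_def)
  have "cmod (p z) \<le> (1 + 2 / (1 - r)) * (3 * (2 * D + 4 * A))"
    using z pz p0 half by (smt (verit) divide_nonneg_nonneg mult_left_mono)
  also have "\<dots> \<le> (1 + 2 / (1 - r)) * (12 * (A + D))"
    using z A0 by (intro mult_left_mono) auto
  finally have "cmod (p z) \<le> (1 + 2 / (1 - r)) * (12 * (A + D))" .
  moreover have "2 * A \<le> 2 * (A + D)" using A0 by simp
  ultimately have "cmod (f z - z) \<le> 2 * (A + D) + (1 + 2 / (1 - r)) * (12 * (A + D))"
    using fz by (meson add_mono order_trans)
  also have "\<dots> = (14 + 24 / (1 - r)) * (A + D)" by (simp add: algebra_simps add_divide_distrib)
  finally show ?thesis by (simp add: A_def D_def)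
qed

lemma holomorphic_Lipschitz_of_bounded:
  assumes hol: "f holomorphic_on ball 0 1" and R: "r < R" "R < 1"
    and bd: "\<And>z. cmod z \<le> R \<Longrightarrow> cmod (f z) \<le> M"
    and zw: "cmod z \<le> r" "cmod w \<le> r"
  shows "cmod (f z - f w) \<le> M / (R - r) * cmod (z - w)"
proof (rule field_differentiable_bound[of "cball 0 r" f "deriv f"])
  show "convex (cball 0 r :: complex set)" by simp
  fix x :: complex assume x: "x \<in> cball 0 r"
  have inb: "cmod y \<le> R" if "y \<in> cball x (R - r)" for y
    using x that norm_triangle_sub[of y x] by (auto simp: dist_norm norm_minus_commute)
  then have sub: "cball x (R - r) \<subseteq> ball 0 1" using R by fastforce
  then show "(f has_field_derivative deriv f x) (at x within cball 0 r)"
    using x R by (intro DERIV_subset[OF holomorphic_derivI[OF hol]]) auto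
  have "cmod ((deriv ^^ 1) f x) \<le> fact 1 * M / (R - r) ^ 1"
  proof (rule Cauchy_inequality)
    show "f holomorphic_on ball x (R - r)"
      using sub ball_subset_cball by (intro holomorphic_on_subset[OF hol]) blast
    show "continuous_on (cball x (R - r)) f"
      using holomorphic_on_imp_continuous_on[OF hol] sub continuous_on_subset by blast
    show "cmod (f y) \<le> M" if "cmod (x - y) = R - r" for y
      using that by (intro bd inb) (simp add: dist_norm)
  qed (use R in auto)
  then show "cmod (deriv f x) \<le> M / (R - r)" by simp
qed (use zw in auto)

text \<open>A Vitali-type convergence theorem along an arbitrary filter. Local boundedness makes the family
  equi-Lipschitz on every smaller disc, so convergence spreads from a dense set to the whole disc and
  is locally uniform. The second conclusion lets the argument move together with the parameter; that
  is the form needed for differentiating along trajectories.\<close>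
lemma locally_bounded_converges_on_dense:
  fixes q :: "'a \<Rightarrow> complex \<Rightarrow> complex"
  assumes F: "F \<noteq> bot"
    and hol: "\<forall>\<^sub>F h in F. q h holomorphic_on ball 0 1"
    and bd: "\<And>r. r < 1 \<Longrightarrow> \<exists>M. \<forall>\<^sub>F h in F. \<forall>z. cmod z \<le> r \<longrightarrow> cmod (q h z) \<le> M"
    and Z: "Z \<subseteq> ball 0 1" "ball 0 1 \<subseteq> closure Z"
    and conv: "\<And>z. z \<in> Z \<Longrightarrow> \<exists>l. ((\<lambda>h. q h z) \<longlongrightarrow> l) F"
  obtains L where "L holomorphic_on ball 0 1"
    "\<And>z w. cmod z < 1 \<Longrightarrow> (w \<longlongrightarrow> z) F \<Longrightarrow> ((\<lambda>h. q h (w h)) \<longlongrightarrow> L z) F"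
proof -
  have Lip: "\<exists>M>0. \<forall>\<^sub>F h in F. \<forall>z w. cmod z \<le> r \<longrightarrow> cmod w \<le> r \<longrightarrow>
      cmod (q h z - q h w) \<le> M * cmod (z - w)" if r: "r < 1" for r
  proof -
    define R where "R = (1 + r) / 2"
    have R: "r < R" "R < 1" using r by (auto simp: R_def)
    obtain M where M: "\<forall>\<^sub>F h in F. \<forall>z. cmod z \<le> R \<longrightarrow> cmod (q h z) \<le> M" using bd R by blast
    define K where "K = max 1 (M / (R - r))"
    have "\<forall>\<^sub>F h in F. \<forall>z w. cmod z \<le> r \<longrightarrow> cmod w \<le> r \<longrightarrow> cmod (q h z - q h w) \<le> K * cmod (z - w)"
      using M hol
    proof eventually_elim
      case (elim h)
      show ?case
      proof (intro allI impI)
        fix z w assume "cmod z \<le> r" "cmod w \<le> r"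
        then have "cmod (q h z - q h w) \<le> M / (R - r) * cmod (z - w)"
          using elim R by (intro holomorphic_Lipschitz_of_bounded) auto
        also have "\<dots> \<le> K * cmod (z - w)" by (intro mult_right_mono) (auto simp: K_def)
        finally show "cmod (q h z - q h w) \<le> K * cmod (z - w)" .
      qed
    qed
    then show ?thesis by (intro exI[of _ K]) (auto simp: K_def)
  qed
  have "\<exists>l. ((\<lambda>h. q h z) \<longlongrightarrow> l) F" if z: "cmod z < 1" for z
  proof -
    define r where "r = (1 + cmod z) / 2"
    have r: "cmod z < r" "r < 1" using z by (auto simp: r_def)
    obtain M where M: "M > 0" "\<forall>\<^sub>F h in F. \<forall>z w. cmod z \<le> r \<longrightarrow> cmod w \<le> r \<longrightarrow>
      cmod (q h z - q h w) \<le> M * cmod (z - w)" using Lip r by blast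
    have "cauchy_filter (filtermap (\<lambda>h. q h z) F)"
      unfolding cauchy_filter_metric_filtermap
    proof (intro allI impI)
      fix e :: real assume e: "e > 0"
      define \<delta> where "\<delta> = min (r - cmod z) (e / (4 * M))"
      have "\<delta> > 0" using e M r by (simp add: \<delta>_def)
      then obtain y where y: "y \<in> Z" "dist y z < \<delta>"
        using Z(2) z by (meson closure_approachable mem_ball_0 subsetD)
      have yz: "cmod (y - z) < e / (4 * M)" "cmod y \<le> r"
        using y norm_triangle_sub[of y z] by (auto simp: \<delta>_def dist_norm)
      have My: "M * cmod (z - y) < e / 4"
        using yz M by (simp add: norm_minus_commute pos_less_divide_eq mult.commute mult.left_commute)
      obtain l where "((\<lambda>h. q h y) \<longlongrightarrow> l) F" using conv y by blast
      then have "\<forall>\<^sub>F h in F. dist (q h y) l < e / 4" using e by (intro tendstoD) auto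
      then have "\<forall>\<^sub>F h in F. dist (q h z) l < e / 2"
        using M(2)
      proof eventually_elim
        case (elim h)
        have "cmod (q h z - q h y) \<le> M * cmod (z - y)" using elim r yz by auto
        then have "dist (q h z) (q h y) < e / 4" using My by (simp add: dist_norm)
        then show ?case using elim(1) dist_triangle[of "q h z" l "q h y"] by linarith
      qed
      then show "\<exists>P. eventually P F \<and> (\<forall>x y. P x \<and> P y \<longrightarrow> dist (q x z) (q y z) < e)"
        by (intro exI[of _ "\<lambda>h. dist (q h z) l < e / 2"]) (auto intro: dist_triangle_half_l)
    qed
    then obtain l where "filtermap (\<lambda>h. q h z) F \<le> nhds l"
      using cauchy_filter_complete_converges[of "filtermap (\<lambda>h. q h z) F" UNIV] F complete_UNIV
      by (auto simp: filtermap_bot_iff)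
    then show ?thesis unfolding filterlim_def by blast
  qed
  then obtain L where L: "\<And>z. cmod z < 1 \<Longrightarrow> ((\<lambda>h. q h z) \<longlongrightarrow> L z) F" by metis
  have LLip: "\<exists>M>0. (\<forall>z w. cmod z \<le> r \<longrightarrow> cmod w \<le> r \<longrightarrow> cmod (L z - L w) \<le> M * cmod (z - w)) \<and>
      (\<forall>\<^sub>F h in F. \<forall>z w. cmod z \<le> r \<longrightarrow> cmod w \<le> r \<longrightarrow> cmod (q h z - q h w) \<le> M * cmod (z - w))"
    if r: "r < 1" for r
  proof -
    obtain M where M: "M > 0" "\<forall>\<^sub>F h in F. \<forall>z w. cmod z \<le> r \<longrightarrow> cmod w \<le> r \<longrightarrow>
      cmod (q h z - q h w) \<le> M * cmod (z - w)" using Lip r by blast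
    have "cmod (L z - L w) \<le> M * cmod (z - w)" if zw: "cmod z \<le> r" "cmod w \<le> r" for z w
    proof (rule tendsto_upperbound[of _ _ F])
      show "((\<lambda>h. cmod (q h z - q h w)) \<longlongrightarrow> cmod (L z - L w)) F"
        using zw r by (intro tendsto_intros L) auto
      show "\<forall>\<^sub>F h in F. cmod (q h z - q h w) \<le> M * cmod (z - w)"
        using M(2) zw by (auto elim: eventually_mono)
    qed fact
    with M show ?thesis by blast
  qed
  have ulim: "uniform_limit (cball 0 r) q L F" if r: "r < 1" for r
  proof (rule uniform_limitI)
    fix e :: real assume e: "e > 0"
    obtain M where M: "M > 0" "\<And>z w. cmod z \<le> r \<Longrightarrow> cmod w \<le> r \<Longrightarrow> cmod (L z - L w) \<le> M * cmod (z - w)"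
      "\<forall>\<^sub>F h in F. \<forall>z w. cmod z \<le> r \<longrightarrow> cmod w \<le> r \<longrightarrow> cmod (q h z - q h w) \<le> M * cmod (z - w)"
      using LLip[OF r] by blast
    have "e / (3 * M) > 0" using e M by simp
    then obtain k where k: "finite k" "k \<subseteq> cball (0::complex) r" "cball 0 r \<subseteq> (\<Union>x\<in>k. ball x (e / (3 * M)))"
      using seq_compact_imp_totally_bounded[OF compact_imp_seq_compact[OF compact_cball]] by metis
    have "\<forall>\<^sub>F h in F. \<forall>x\<in>k. dist (q h x) (L x) < e / 3"
    proof (intro eventually_ball_finite k(1) ballI)
      fix x assume "x \<in> k"
      then have "cmod x < 1" using k r by auto
      then show "\<forall>\<^sub>F h in F. dist (q h x) (L x) < e / 3" using e by (intro tendstoD L) auto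
    qed
    then show "\<forall>\<^sub>F h in F. \<forall>x\<in>cball 0 r. dist (q h x) (L x) < e"
      using M(3)
    proof eventually_elim
      case (elim h)
      show ?case
      proof
        fix z :: complex assume z: "z \<in> cball 0 r"
        then obtain x where x: "x \<in> k" "dist x z < e / (3 * M)" using k(3) by (auto simp: dist_commute)
        have xr: "cmod x \<le> r" "cmod z \<le> r" using x k z by auto
        have Mx: "M * cmod (z - x) < e / 3"
          using x M by (simp add: dist_norm norm_minus_commute pos_less_divide_eq mult.commute mult.left_commute)
        have "cmod (q h z - q h x) \<le> M * cmod (z - x)" using elim xr by blast
        then have "dist (q h z) (q h x) < e / 3" using Mx by (simp add: dist_norm)
        moreover have "dist (q h x) (L x) < e / 3" using elim x by blast
        moreover have "dist (L x) (L z) < e / 3"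
          using M(2)[OF xr] Mx by (simp add: dist_norm norm_minus_commute)
        ultimately show "dist (q h z) (L z) < e"
          using dist_triangle[of "q h z" "L z" "q h x"] dist_triangle[of "q h x" "L z" "L x"] by linarith
      qed
    qed
  qed
  show thesis
  proof
    show "L holomorphic_on ball 0 1"
    proof (subst holomorphic_on_open, safe)
      fix z :: complex assume z: "z \<in> ball 0 1"
      define r where "r = (1 + cmod z) / 2"
      have r: "cmod z < r" "r < 1" using z by (auto simp: r_def)
      have "\<forall>\<^sub>F h in F. continuous_on (cball 0 r) (q h) \<and> q h holomorphic_on ball 0 r"
        using hol
      proof eventually_elim
        case (elim h)
        have "cball 0 r \<subseteq> ball (0::complex) 1" "ball 0 r \<subseteq> ball (0::complex) 1" using r by auto
        then show ?case using elim
          by (meson holomorphic_on_imp_continuous_on holomorphic_on_subset continuous_on_subset)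
      qed
      then have "L holomorphic_on ball 0 r"
        using ulim[OF r(2)] F by (rule holomorphic_uniform_limit)
      then show "\<exists>f'. (L has_field_derivative f') (at z)"
        using r holomorphic_derivI[of L "ball 0 r" z] by auto
    qed simp
  next
    fix z w assume z: "cmod z < 1" and w: "(w \<longlongrightarrow> z) F"
    define r where "r = (1 + cmod z) / 2"
    have r: "cmod z < r" "r < 1" using z by (auto simp: r_def)
    obtain M where M: "M > 0" "\<forall>\<^sub>F h in F. \<forall>z w. cmod z \<le> r \<longrightarrow> cmod w \<le> r \<longrightarrow>
      cmod (q h z - q h w) \<le> M * cmod (z - w)" using Lip r by blast
    have "\<forall>\<^sub>F h in F. cmod (w h) < r"
      using tendsto_norm[OF w] r(1) by (rule order_tendstoD)
    then have "\<forall>\<^sub>F h in F. norm (q h (w h) - q h z) \<le> M * cmod (w h - z)"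
      using M(2) by eventually_elim (use r in auto)
    moreover have "((\<lambda>h. M * cmod (w h - z)) \<longlongrightarrow> M * cmod (z - z)) F"
      using w by (intro tendsto_intros)
    then have "((\<lambda>h. M * cmod (w h - z)) \<longlongrightarrow> 0) F" by simp
    ultimately have "((\<lambda>h. q h (w h) - q h z) \<longlongrightarrow> 0) F"
      by (rule Lim_null_comparison)
    then have "((\<lambda>h. q h (w h) - q h z + q h z) \<longlongrightarrow> 0 + L z) F"
      by (intro tendsto_add L z)
    then show "((\<lambda>h. q h (w h)) \<longlongrightarrow> L z) F" by simp
  qed
qed

section \<open>Increments of an evolution family\<close>

lemma L_space_imp_integrable:
  assumes k: "k \<in> L_space d M" and d: "1 \<le> d" and fin: "finite_measure M"
  shows "integrable M k"
proof -
  interpret finite_measure M by fact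
  have meas: "k \<in> borel_measurable M" using k by (simp add: L_space_def)
  show ?thesis
  proof (cases "d = \<infinity>")
    case True
    define e where "e = esssup M (\<lambda>x. ereal \<bar>k x\<bar>)"
    have e: "e < \<infinity>" using k True by (simp add: L_space_def e_def)
    have "AE x in M. ereal \<bar>k x\<bar> \<le> e" unfolding e_def by (rule esssup_AE)
    then have "AE x in M. norm (k x) \<le> real_of_ereal e"
      by eventually_elim (use e in \<open>cases e; auto\<close>)
    then show ?thesis using meas by (rule integrable_const_bound)
  next
    case False
    then obtain p where p: "d = ereal p" "p \<ge> 1" using d by (cases d) auto
    have int: "integrable M (\<lambda>x. \<bar>k x\<bar> powr p)" using k p by (simp add: L_space_def)
    show ?thesis
    proof (rule Bochner_Integration.integrable_bound[OF _ meas])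
      show "integrable M (\<lambda>x. 1 + \<bar>k x\<bar> powr p)" using int by simp
      show "AE x in M. norm (k x) \<le> norm (1 + \<bar>k x\<bar> powr p)"
      proof (intro AE_I2)
        fix x
        have "\<bar>k x\<bar> \<le> 1 + \<bar>k x\<bar> powr p"
        proof (cases "\<bar>k x\<bar> \<le> 1")
          case False
          then have "\<bar>k x\<bar> powr 1 \<le> \<bar>k x\<bar> powr p" using p by (intro powr_mono) auto
          then show ?thesis using False by simp
        qed (simp add: add_increasing2)
        then show "norm (k x) \<le> norm (1 + \<bar>k x\<bar> powr p)" by simp
      qed
    qed
  qed
qed

text \<open>The primitive is extended to a monotone continuous function on the whole line by freezing it
  outside \<open>{0..T}\<close>, so that differentiation theorems on the line apply.\<close>
lemma L_space_indefinite_integral: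
  fixes T :: real
  assumes k: "k \<in> L_space d (lebesgue_on {0..T})" "\<And>\<xi>. \<xi> \<in> {0..T} \<Longrightarrow> 0 \<le> k \<xi>" and d: "1 \<le> d"
  obtains m where "mono m" "continuous_on UNIV m"
    "\<And>u t. 0 \<le> u \<Longrightarrow> u \<le> t \<Longrightarrow> t \<le> T \<Longrightarrow> (LINT \<xi>:{u..t}|lebesgue. k \<xi>) = m t - m u"
proof -
  have "finite_measure (lebesgue_on {0..T})"
    using finite_measure_lebesgue_on[OF lmeasurable_cbox[of 0 T]] by simp
  then have "integrable (lebesgue_on {0..T}) k"
    using k(1) d by (intro L_space_imp_integrable)
  then have int: "set_integrable lebesgue {0..T} k"
    by (subst (asm) integrable_restrict_space) (auto simp: set_integrable_def)
  have sub: "set_integrable lebesgue {u..t} k" if "0 \<le> u" "t \<le> T" for u t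
    using that by (intro set_integrable_subset[OF int]) auto
  have kint: "k integrable_on {u..t}" if "0 \<le> u" "t \<le> T" for u t
    using sub[OF that] by (rule set_lebesgue_integral_eq_integral(1))
  define c where "c x = max 0 (min T x)" for x
  define m where "m x = integral {0..c x} k" for x
  show thesis
  proof (cases "0 \<le> T")
    case True
    have c: "0 \<le> c x" "c x \<le> T" for x using True by (auto simp: c_def)
    have diff: "integral {u..t} k = integral {0..t} k - integral {0..u} k"
      if "0 \<le> u" "u \<le> t" "t \<le> T" for u t
      using Henstock_Kurzweil_Integration.integral_combine[OF that(1,2) kint] that by simp
    show thesis
    proof
      show "mono m"
      proof
        fix x y :: real assume "x \<le> y"
        then have le: "c x \<le> c y" by (auto simp: c_def)
        have "0 \<le> integral {c x..c y} k"
          using c[of x] c[of y] by (intro integral_nonneg kint k(2)) auto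
        then show "m x \<le> m y" using diff[OF c(1) le c(2)] by (simp add: m_def)
      qed
      have "continuous_on {0..T} (\<lambda>x. integral {0..x} k)"
        using kint by (intro indefinite_integral_continuous_1) auto
      moreover have "continuous_on UNIV c" unfolding c_def by (intro continuous_intros)
      ultimately show "continuous_on UNIV m"
        unfolding m_def by (rule continuous_on_compose2) (use c in auto)
      fix u t assume ut: "0 \<le> u" "u \<le> t" "t \<le> T"
      have "(LINT \<xi>:{u..t}|lebesgue. k \<xi>) = integral {u..t} k"
        using sub ut by (intro set_lebesgue_integral_eq_integral(2)) auto
      then show "(LINT \<xi>:{u..t}|lebesgue. k \<xi>) = m t - m u"
        using diff[OF ut] ut by (simp add: m_def c_def)
    qed
  next
    case False
    show thesis by (rule that[of "\<lambda>_. 0"]) (use False in \<open>auto simp: mono_def\<close>)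
  qed
qed

lemma evolution_familyD:
  assumes "evolution_family d \<phi>"
  shows "0 \<le> s \<Longrightarrow> s \<le> t \<Longrightarrow> \<phi> s t holomorphic_on ball 0 1"
    and "0 \<le> s \<Longrightarrow> s \<le> t \<Longrightarrow> cmod z < 1 \<Longrightarrow> cmod (\<phi> s t z) < 1"
    and "0 \<le> s \<Longrightarrow> cmod z < 1 \<Longrightarrow> \<phi> s s z = z"
    and "0 \<le> s \<Longrightarrow> s \<le> u \<Longrightarrow> u \<le> t \<Longrightarrow> cmod z < 1 \<Longrightarrow> \<phi> u t (\<phi> s u z) = \<phi> s t z"
proof -
  have self: "holomorphic_self_map (\<phi> s t)" if "0 \<le> s" "s \<le> t" for s t
    using assms[unfolded evolution_family_def, THEN conjunct1] that by blast
  show "0 \<le> s \<Longrightarrow> s \<le> t \<Longrightarrow> \<phi> s t holomorphic_on ball 0 1"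
    using self unfolding holomorphic_self_map_def by blast
  show "cmod (\<phi> s t z) < 1" if "0 \<le> s" "s \<le> t" "cmod z < 1"
  proof -
    have "\<phi> s t z \<in> ball 0 1"
      using self[OF that(1,2)] that(3) by (auto simp: holomorphic_self_map_def image_subset_iff)
    then show ?thesis by simp
  qed
  show "\<phi> s s z = z" if "0 \<le> s" "cmod z < 1"
    using assms[unfolded evolution_family_def, THEN conjunct2, THEN conjunct1] that by simp
  show "\<phi> u t (\<phi> s u z) = \<phi> s t z" if "0 \<le> s" "s \<le> u" "u \<le> t" "cmod z < 1"
    using assms[unfolded evolution_family_def, THEN conjunct2, THEN conjunct2, THEN conjunct1,
        rule_format, of s u t z] that by simp
qed

text \<open>The definition of an evolution family provides a majorant \<open>k\<close> for each point separately. Those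
  for the points \<open>0\<close> and \<open>1/2\<close> suffice, by \<open>self_map_near_id\<close>, so one function \<open>m\<close> serves all \<open>z\<close>, up
  to a constant on each smaller disc.\<close>
lemma evolution_family_near_id:
  assumes ev: "evolution_family d \<phi>" and d: "1 \<le> d" and T: "0 < T"
  obtains m where "mono m" "continuous_on UNIV m"
    "\<And>r. r < 1 \<Longrightarrow> \<exists>C\<ge>0. \<forall>s u z. 0 \<le> s \<longrightarrow> s \<le> u \<longrightarrow> u \<le> T \<longrightarrow> cmod z \<le> r \<longrightarrow>
        cmod (\<phi> s u z - z) \<le> C * (m u - m s)"
proof -
  have self: "\<phi> s u holomorphic_on ball 0 1" "\<phi> s u ` ball 0 1 \<subseteq> ball 0 1" if "0 \<le> s" "s \<le> u" for s u
    using evolution_familyD(1,2)[OF ev that] by (auto simp: image_subset_iff)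
  have "\<exists>m. mono m \<and> continuous_on UNIV m \<and>
      (\<forall>s u. 0 \<le> s \<longrightarrow> s \<le> u \<longrightarrow> u \<le> T \<longrightarrow> cmod (\<phi> s u z - z) \<le> m u - m s)" if z: "z \<in> ball 0 1" for z
  proof -
    obtain k where k: "k \<in> L_space d (lebesgue_on {0..T})" "\<And>\<xi>. \<xi> \<in> {0..T} \<Longrightarrow> 0 \<le> k \<xi>"
      "\<And>s u t. 0 \<le> s \<and> s \<le> u \<and> u \<le> t \<and> t \<le> T \<Longrightarrow>
           cmod (\<phi> s u z - \<phi> s t z) \<le> (LINT \<xi>:{u..t}|lebesgue. k \<xi>)"
      using ev z T unfolding evolution_family_def by meson
    obtain m where m: "mono m" "continuous_on UNIV m"
      "\<And>u t. 0 \<le> u \<Longrightarrow> u \<le> t \<Longrightarrow> t \<le> T \<Longrightarrow> (LINT \<xi>:{u..t}|lebesgue. k \<xi>) = m t - m u"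
      using L_space_indefinite_integral[OF k(1,2) d] by metis
    have "cmod (\<phi> s u z - z) \<le> m u - m s" if su: "0 \<le> s" "s \<le> u" "u \<le> T" for s u
    proof -
      have "\<phi> s s z = z" using evolution_familyD(3)[OF ev] z su by simp
      then show ?thesis using k(3)[of s s u] m(3)[OF su] su by (simp add: norm_minus_commute)
    qed
    with m show ?thesis by blast
  qed
  from this[of 0] this[of "1/2"] obtain m0 m1 where
    m0: "mono m0" "continuous_on UNIV m0"
      "\<And>s u. 0 \<le> s \<Longrightarrow> s \<le> u \<Longrightarrow> u \<le> T \<Longrightarrow> cmod (\<phi> s u 0 - 0) \<le> m0 u - m0 s" and
    m1: "mono m1" "continuous_on UNIV m1"
      "\<And>s u. 0 \<le> s \<Longrightarrow> s \<le> u \<Longrightarrow> u \<le> T \<Longrightarrow> cmod (\<phi> s u (1/2) - 1/2) \<le> m1 u - m1 s"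
    by auto
  define m where "m x = m0 x + m1 x" for x
  show thesis
  proof
    show "mono m" using m0(1) m1(1) by (auto simp: mono_def m_def intro: add_mono)
    show "continuous_on UNIV m" unfolding m_def by (intro continuous_intros m0 m1)
    fix r :: real assume r: "r < 1"
    define C where "C = 14 + 24 / (1 - r)"
    have C0: "C \<ge> 0" using r by (simp add: C_def)
    have "cmod (\<phi> s u z - z) \<le> C * (m u - m s)" if su: "0 \<le> s" "s \<le> u" "u \<le> T" "cmod z \<le> r" for s u z
    proof -
      have "cmod (\<phi> s u z - z) \<le> C * (cmod (\<phi> s u 0) + cmod (\<phi> s u (1/2) - 1/2))"
        unfolding C_def using su r self by (intro self_map_near_id) auto
      also have "\<dots> \<le> C * (m u - m s)"
        using m0(3)[of s u] m1(3)[of s u] su by (intro mult_left_mono C0) (auto simp: m_def)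
      finally show ?thesis .
    qed
    with C0 show "\<exists>C\<ge>0. \<forall>s u z. 0 \<le> s \<longrightarrow> s \<le> u \<longrightarrow> u \<le> T \<longrightarrow> cmod z \<le> r \<longrightarrow>
        cmod (\<phi> s u z - z) \<le> C * (m u - m s)" by blast
  qed
qed

text \<open>Since \<open>\<phi> s t = \<phi> u t \<circ> \<phi> s u\<close>, changing the initial time means evaluating the self-map
  \<open>\<phi> u t\<close> at \<open>z\<close> and at the nearby point \<open>\<phi> s u z\<close>. Self-maps are Lipschitz on smaller discs; if
  \<open>\<phi> s u z\<close> has left such a disc, then \<open>C (m u - m s)\<close> is so large that the trivial bound \<open>2\<close> is
  enough.\<close>
lemma evolution_family_initial_time:
  assumes ev: "evolution_family d \<phi>" and r: "r < 1" and C: "C \<ge> 0"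
    and near: "\<And>s u z. 0 \<le> s \<Longrightarrow> s \<le> u \<Longrightarrow> u \<le> t \<Longrightarrow> cmod z \<le> r \<Longrightarrow>
        cmod (\<phi> s u z - z) \<le> C * (m u - m s)"
    and su: "0 \<le> s" "s \<le> u" "u \<le> t" and z: "cmod z \<le> r"
  shows "cmod (\<phi> u t z - \<phi> s t z) \<le> 4 / (1 - r) * C * (m u - m s)"
proof -
  note self = evolution_familyD(1,2)[OF ev]
  define w where "w = \<phi> s u z"
  have z1: "cmod z < 1" using z r by simp
  have st: "\<phi> s t z = \<phi> u t w"
    using evolution_familyD(4)[OF ev su z1] by (simp add: w_def)
  have near': "cmod (w - z) \<le> C * (m u - m s)" unfolding w_def using near su z by blast
  \<comment> \<open>three nested discs of radii \<open>r < \<rho> < R < 1\<close>: for \<open>z\<close>, for \<open>\<phi> s u z\<close>, and for Cauchy's estimate\<close>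
  define \<rho> where "\<rho> = (1 + r) / 2"
  define R where "R = (1 + \<rho>) / 2"
  have R: "\<rho> < R" "R < 1" "R - \<rho> = (1 - r) / 4" "\<rho> - r = (1 - r) / 2"
    using r by (auto simp: R_def \<rho>_def field_simps)
  show ?thesis
  proof (cases "cmod w \<le> \<rho>")
    case True
    have "cmod (\<phi> u t z - \<phi> u t w) \<le> 1 / (R - \<rho>) * cmod (z - w)"
    proof (rule holomorphic_Lipschitz_of_bounded[OF _ R(1,2)])
      show "\<phi> u t holomorphic_on ball 0 1" using self su by auto
      show "cmod (\<phi> u t x) \<le> 1" if "cmod x \<le> R" for x
        using self(2)[of u t x] su that R by simp
      show "cmod z \<le> \<rho>" using z R r by simp
    qed fact
    also have "\<dots> \<le> 1 / (R - \<rho>) * (C * (m u - m s))"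
      using near' R by (intro mult_left_mono) (auto simp: norm_minus_commute)
    finally show ?thesis using R(3) st by (simp add: field_simps)
  next
    case False
    then have "\<rho> - r \<le> cmod (w - z)" using z norm_triangle_sub[of w z] by simp
    then have "(1 - r) / 2 \<le> C * (m u - m s)" using near' R by simp
    then have "2 \<le> 4 / (1 - r) * C * (m u - m s)" using r by (simp add: field_simps)
    moreover have "cmod (\<phi> u t z - \<phi> s t z) \<le> 2"
      using norm_triangle_ineq4[of "\<phi> u t z" "\<phi> s t z"] self(2)[of u t z] self(2)[of s t z] su z1
      by (smt (verit))
    ultimately show ?thesis by linarith
  qed
qed

section \<open>Differentiability in the initial time\<close>

text \<open>Adding \<open>m\<close> to the real and imaginary parts of \<open>x\<close> makes them monotone.\<close>
lemma dominated_increments_differentiable: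
  fixes x :: "real \<Rightarrow> complex"
  assumes m: "mono m" "continuous_on UNIV m" and le: "\<And>s u. s \<le> u \<Longrightarrow> cmod (x u - x s) \<le> m u - m s"
  shows "\<exists>N \<in> null_sets lebesgue. \<forall>s. s \<notin> N \<longrightarrow>
      (\<exists>D. ((\<lambda>h. (x (s + h) - x s) / of_real h) \<longlongrightarrow> D) (at 0))"
proof -
  have le': "cmod (x u - x s) \<le> \<bar>m u - m s\<bar>" for s u
    using le[of s u] le[of u s] by (cases "s \<le> u") (auto simp: norm_minus_commute)
  have contx: "continuous_on UNIV x"
    unfolding continuous_on_def
  proof
    fix s
    have "((\<lambda>u. \<bar>m u - m s\<bar>) \<longlongrightarrow> \<bar>m s - m s\<bar>) (at s)"
      using m(2) by (intro tendsto_intros) (auto simp: continuous_on_def)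
    then have "((\<lambda>u. x u - x s) \<longlongrightarrow> 0) (at s)"
      by (intro Lim_null_comparison[OF always_eventually[OF allI[OF le']]]) simp
    then show "(x \<longlongrightarrow> x s) (at s)" by (simp add: LIM_zero_iff)
  qed
  have diff: "\<exists>N \<in> null_sets lebesgue. \<forall>s. s \<notin> N \<longrightarrow> (\<exists>D. ((\<lambda>y. f y + m y) has_real_derivative D) (at s))"
    if f: "continuous_on UNIV f" "\<And>s u. \<bar>f u - f s\<bar> \<le> cmod (x u - x s)" for f
  proof (rule Lebesgue_mono_differentiable)
    show "mono (\<lambda>y. f y + m y)"
    proof
      fix s u :: real assume "s \<le> u"
      then show "f s + m s \<le> f u + m u" using f(2)[of u s] le[of s u] by linarith
    qed
    show "continuous_on UNIV (\<lambda>y. f y + m y)" using f m by (intro continuous_intros)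
  qed
  obtain N0 where N0: "N0 \<in> null_sets lebesgue" "\<And>s. s \<notin> N0 \<Longrightarrow> \<exists>D. (m has_real_derivative D) (at s)"
    using Lebesgue_mono_differentiable[OF m] by blast
  obtain N1 where N1: "N1 \<in> null_sets lebesgue"
      "\<And>s. s \<notin> N1 \<Longrightarrow> \<exists>D. ((\<lambda>y. Re (x y) + m y) has_real_derivative D) (at s)"
    using diff[of "\<lambda>y. Re (x y)"] contx abs_Re_le_cmod[of "x u - x s" for u s]
    by (auto intro: continuous_intros)
  obtain N2 where N2: "N2 \<in> null_sets lebesgue"
      "\<And>s. s \<notin> N2 \<Longrightarrow> \<exists>D. ((\<lambda>y. Im (x y) + m y) has_real_derivative D) (at s)"
    using diff[of "\<lambda>y. Im (x y)"] contx abs_Im_le_cmod[of "x u - x s" for u s]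
    by (auto intro: continuous_intros)
  have "\<exists>D. ((\<lambda>h. (x (s + h) - x s) / of_real h) \<longlongrightarrow> D) (at 0)" if s: "s \<notin> N0 \<union> N1 \<union> N2" for s
  proof -
    obtain D0 D1 D2 where D: "(m has_real_derivative D0) (at s)"
      "((\<lambda>y. Re (x y) + m y) has_real_derivative D1) (at s)"
      "((\<lambda>y. Im (x y) + m y) has_real_derivative D2) (at s)"
      using s N0 N1 N2 by blast
    have "((\<lambda>y. Re (x y)) has_real_derivative D1 - D0) (at s)"
      "((\<lambda>y. Im (x y)) has_real_derivative D2 - D0) (at s)"
      using DERIV_diff[OF D(2,1)] DERIV_diff[OF D(3,1)] by simp_all
    then have "((\<lambda>h. Complex ((Re (x (s + h)) - Re (x s)) / h) ((Im (x (s + h)) - Im (x s)) / h))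
        \<longlongrightarrow> Complex (D1 - D0) (D2 - D0)) (at 0)"
      unfolding DERIV_def by (intro tendsto_intros)
    moreover have "Complex ((Re (x (s + h)) - Re (x s)) / h) ((Im (x (s + h)) - Im (x s)) / h)
        = (x (s + h) - x s) / of_real h" for h
      by (simp add: complex_eq_iff)
    ultimately show ?thesis by auto
  qed
  moreover have "N0 \<union> N1 \<union> N2 \<in> null_sets lebesgue" using N0 N1 N2 by auto
  ultimately show ?thesis by blast
qed

text \<open>The exceptional set consists of the points where \<open>m\<close> is not differentiable and of those where
  \<open>\<phi> \<cdot> t z\<close> is not, for some \<open>z\<close> in a countable dense set. Elsewhere the difference quotients
  converge on that dense set, and they are locally bounded because those of \<open>m\<close> are bounded.\<close>
lemma evolution_family_quotient_limit:
  assumes ev: "evolution_family d \<phi>" and t: "0 < t"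
    and m: "mono m" "continuous_on UNIV m"
    and near: "\<And>r. r < 1 \<Longrightarrow> \<exists>C\<ge>0. \<forall>s u z. 0 \<le> s \<longrightarrow> s \<le> u \<longrightarrow> u \<le> t \<longrightarrow> cmod z \<le> r \<longrightarrow>
        cmod (\<phi> s u z - z) \<le> C * (m u - m s)"
  shows "\<exists>N \<in> null_sets lebesgue. \<forall>s \<in> {0<..<t} - N. \<exists>L. L holomorphic_on ball 0 1 \<and>
    (\<forall>z w. cmod z < 1 \<longrightarrow> (w \<longlongrightarrow> z) (at 0) \<longrightarrow> ((\<lambda>h. s_quotient \<phi> s t (w h) h) \<longlongrightarrow> L z) (at 0))"
proof -
  have incr: "\<exists>C\<ge>0. \<forall>s u z. 0 \<le> s \<longrightarrow> s \<le> u \<longrightarrow> u \<le> t \<longrightarrow> cmod z \<le> r \<longrightarrow>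
        cmod (\<phi> u t z - \<phi> s t z) \<le> C * (m u - m s)" if r: "r < 1" for r
  proof -
    obtain C where C: "C \<ge> 0" "\<And>s u z. 0 \<le> s \<Longrightarrow> s \<le> u \<Longrightarrow> u \<le> t \<Longrightarrow> cmod z \<le> r \<Longrightarrow>
        cmod (\<phi> s u z - z) \<le> C * (m u - m s)" using near[OF r] by blast
    show ?thesis
      using evolution_family_initial_time[OF ev r C] r C(1)
      by (intro exI[of _ "4 / (1 - r) * C"]) auto
  qed
  obtain Z :: "complex set" where Z: "countable Z" "Z \<subseteq> ball 0 1" "ball 0 1 \<subseteq> closure Z"
    using separable by blast
  have "\<exists>N \<in> null_sets lebesgue. \<forall>s \<in> {0<..<t} - N. \<exists>D. ((\<lambda>h. s_quotient \<phi> s t z h) \<longlongrightarrow> D) (at 0)"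
    if z: "z \<in> Z" for z
  proof -
    have z1: "cmod z < 1" using z Z by auto
    obtain C where C: "C \<ge> 0" "\<And>s u. 0 \<le> s \<Longrightarrow> s \<le> u \<Longrightarrow> u \<le> t \<Longrightarrow>
        cmod (\<phi> u t z - \<phi> s t z) \<le> C * (m u - m s)" using incr[OF z1] by auto
    \<comment> \<open>clamping the initial time to \<open>{0..t}\<close> gives a function on the whole line\<close>
    define c where "c x = max 0 (min t x)" for x
    have c: "0 \<le> c x" "c x \<le> t" for x using t by (auto simp: c_def)
    have cmono: "c x \<le> c y" if "x \<le> y" for x y using that by (auto simp: c_def)
    have "\<exists>N \<in> null_sets lebesgue. \<forall>s. s \<notin> N \<longrightarrow>
      (\<exists>D. ((\<lambda>h. (\<phi> (c (s + h)) t z - \<phi> (c s) t z) / of_real h) \<longlongrightarrow> D) (at 0))"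
    proof (rule dominated_increments_differentiable)
      show "mono (\<lambda>x. C * m (c x))"
        using C(1) monoD[OF m(1)] cmono by (auto simp: mono_def intro!: mult_left_mono)
      have "continuous_on UNIV c" unfolding c_def by (intro continuous_intros)
      then show "continuous_on UNIV (\<lambda>x. C * m (c x))"
        by (intro continuous_intros continuous_on_compose2[OF m(2)]) auto
      show "cmod (\<phi> (c u) t z - \<phi> (c s) t z) \<le> C * m (c u) - C * m (c s)" if "s \<le> u" for s u
        using C(2)[OF c(1)[of s] cmono[OF that] c(2)] by (simp add: algebra_simps)
    qed
    then obtain N where N: "N \<in> null_sets lebesgue" "\<And>s. s \<notin> N \<Longrightarrow>
      \<exists>D. ((\<lambda>h. (\<phi> (c (s + h)) t z - \<phi> (c s) t z) / of_real h) \<longlongrightarrow> D) (at 0)" by blast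
    have "\<exists>D. ((\<lambda>h. s_quotient \<phi> s t z h) \<longlongrightarrow> D) (at 0)" if s: "s \<in> {0<..<t} - N" for s
    proof -
      obtain D where D: "((\<lambda>h. (\<phi> (c (s + h)) t z - \<phi> (c s) t z) / of_real h) \<longlongrightarrow> D) (at 0)"
        using N(2) s by blast
      have "\<forall>\<^sub>F h in at 0. s + h \<in> {0<..<t}"
        by (rule topological_tendstoD[where l = s]) (use s in \<open>auto intro!: tendsto_eq_intros\<close>)
      then have "\<forall>\<^sub>F h in at 0. (\<phi> (c (s + h)) t z - \<phi> (c s) t z) / of_real h = s_quotient \<phi> s t z h"
        by eventually_elim (use s in \<open>auto simp: s_quotient_def c_def\<close>)
      then show ?thesis using Lim_transform_eventually[OF D] by blast
    qed
    with N(1) show ?thesis by blast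
  qed
  then obtain NZ where NZ: "\<And>z. z \<in> Z \<Longrightarrow> NZ z \<in> null_sets lebesgue"
    "\<And>z s. z \<in> Z \<Longrightarrow> s \<in> {0<..<t} - NZ z \<Longrightarrow> \<exists>D. ((\<lambda>h. s_quotient \<phi> s t z h) \<longlongrightarrow> D) (at 0)"
    by metis
  obtain Nm where Nm: "Nm \<in> null_sets lebesgue" "\<And>s. s \<notin> Nm \<Longrightarrow> \<exists>D. (m has_real_derivative D) (at s)"
    using Lebesgue_mono_differentiable[OF m] by blast
  define N where "N = Nm \<union> (\<Union>z\<in>Z. NZ z)"
  have "N \<in> null_sets lebesgue"
    unfolding N_def using Nm NZ Z by (intro null_sets.Un null_sets_UN') auto
  moreover have "\<exists>L. L holomorphic_on ball 0 1 \<and>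
    (\<forall>z w. cmod z < 1 \<longrightarrow> (w \<longlongrightarrow> z) (at 0) \<longrightarrow> ((\<lambda>h. s_quotient \<phi> s t (w h) h) \<longlongrightarrow> L z) (at 0))"
    if s: "s \<in> {0<..<t} - N" for s
  proof -
    have ev_int: "\<forall>\<^sub>F h in at 0. s + h \<in> {0<..<t}"
      by (rule topological_tendstoD[where l = s]) (use s in \<open>auto intro!: tendsto_eq_intros\<close>)
    obtain D where D: "(m has_real_derivative D) (at s)" using Nm s by (auto simp: N_def)
    have hol: "\<forall>\<^sub>F h in at 0. (\<lambda>z. s_quotient \<phi> s t z h) holomorphic_on ball 0 1"
      using ev_int eventually_neq_at_within[of 0]
    proof eventually_elim
      case (elim h)
      have "\<phi> (s + h) t holomorphic_on ball 0 1" "\<phi> s t holomorphic_on ball 0 1"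
        using elim s by (auto intro!: evolution_familyD(1)[OF ev])
      then show ?case unfolding s_quotient_def using elim by (intro holomorphic_intros) auto
    qed
    have bd: "\<exists>M. \<forall>\<^sub>F h in at 0. \<forall>z. cmod z \<le> r \<longrightarrow> cmod (s_quotient \<phi> s t z h) \<le> M" if r: "r < 1" for r
    proof -
      obtain C where C: "C \<ge> 0" "\<And>s u z. 0 \<le> s \<Longrightarrow> s \<le> u \<Longrightarrow> u \<le> t \<Longrightarrow> cmod z \<le> r \<Longrightarrow>
        cmod (\<phi> u t z - \<phi> s t z) \<le> C * (m u - m s)" using incr[OF r] by blast
      have "((\<lambda>h. \<bar>(m (s + h) - m s) / h\<bar>) \<longlongrightarrow> \<bar>D\<bar>) (at 0)"
        using D unfolding DERIV_def by (intro tendsto_intros)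
      then have "\<forall>\<^sub>F h in at 0. \<bar>(m (s + h) - m s) / h\<bar> < \<bar>D\<bar> + 1"
        by (rule order_tendstoD) simp
      then have "\<forall>\<^sub>F h in at 0. \<forall>z. cmod z \<le> r \<longrightarrow> cmod (s_quotient \<phi> s t z h) \<le> C * (\<bar>D\<bar> + 1)"
        using ev_int eventually_neq_at_within[of 0]
      proof eventually_elim
        case (elim h)
        show ?case
        proof (intro allI impI)
          fix z assume z: "cmod z \<le> r"
          have "cmod (\<phi> (s + h) t z - \<phi> s t z) \<le> C * \<bar>m (s + h) - m s\<bar>"
          proof (cases "h \<ge> 0")
            case True
            then have "cmod (\<phi> (s + h) t z - \<phi> s t z) \<le> C * (m (s + h) - m s)"
              using s elim z by (intro C) auto
            also have "\<dots> \<le> C * \<bar>m (s + h) - m s\<bar>" using C(1) by (intro mult_left_mono) auto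
            finally show ?thesis .
          next
            case False
            then have "cmod (\<phi> s t z - \<phi> (s + h) t z) \<le> C * (m s - m (s + h))"
              using s elim z by (intro C) auto
            also have "\<dots> \<le> C * \<bar>m (s + h) - m s\<bar>" using C(1) by (intro mult_left_mono) auto
            finally show ?thesis by (simp add: norm_minus_commute)
          qed
          then have "cmod (s_quotient \<phi> s t z h) \<le> C * \<bar>(m (s + h) - m s) / h\<bar>"
            unfolding s_quotient_def norm_divide by (simp add: divide_right_mono)
          also have "\<dots> \<le> C * (\<bar>D\<bar> + 1)" using elim C(1) by (intro mult_left_mono) auto
          finally show "cmod (s_quotient \<phi> s t z h) \<le> C * (\<bar>D\<bar> + 1)" .
        qed
      qed
      then show ?thesis by blast
    qed
    have conv: "\<exists>l. ((\<lambda>h. s_quotient \<phi> s t z h) \<longlongrightarrow> l) (at 0)" if "z \<in> Z" for z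
      using NZ(2)[OF that, of s] s that by (auto simp: N_def)
    obtain L where "L holomorphic_on ball 0 1"
      "\<And>z w. cmod z < 1 \<Longrightarrow> (w \<longlongrightarrow> z) (at 0) \<Longrightarrow> ((\<lambda>h. s_quotient \<phi> s t (w h) h) \<longlongrightarrow> L z) (at 0)"
      by (rule locally_bounded_converges_on_dense[OF trivial_limit_at hol bd Z(2,3) conv]) blast+
    then show ?thesis by blast
  qed
  ultimately show ?thesis by blast
qed

section \<open>The differential equation in the initial time\<close>

lemma has_vector_derivative_quotient:
  fixes f :: "real \<Rightarrow> complex"
  assumes "(f has_vector_derivative D) (at s)"
  shows "((\<lambda>h. (f (s + h) - f s) / of_real h) \<longlongrightarrow> D) (at 0)"
proof -
  have "((\<lambda>h. norm (f (s + h) - f s - h *\<^sub>R D) / norm h) \<longlongrightarrow> 0) (at 0)"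
    using assms unfolding has_vector_derivative_def has_derivative_at by blast
  moreover have "\<forall>\<^sub>F h in at 0. norm (f (s + h) - f s - h *\<^sub>R D) / norm h
      = norm ((f (s + h) - f s) / of_real h - D)"
    using eventually_neq_at_within[of 0]
  proof eventually_elim
    case (elim h)
    then have "(f (s + h) - f s) / of_real h - D = (f (s + h) - f s - h *\<^sub>R D) / of_real h"
      by (simp add: scaleR_conv_of_real field_simps)
    then show ?case by (simp add: norm_divide)
  qed
  ultimately have "((\<lambda>h. norm ((f (s + h) - f s) / of_real h - D)) \<longlongrightarrow> 0) (at 0)"
    by (rule Lim_transform_eventually)
  then show ?thesis by (simp add: LIM_zero_iff tendsto_norm_zero_iff)
qed

text \<open>The function \<open>\<sigma> \<mapsto> \<phi> \<sigma> t (\<phi> r \<sigma> y)\<close> is constant, equal to \<open>\<phi> r t y\<close>; differentiating it at \<open>s\<close>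
  gives the equation at the point \<open>\<phi> r s y\<close>. Only countably many \<open>r\<close> and \<open>y\<close> can be used if the
  exceptional set of times is to be null, but the points \<open>\<phi> r s y\<close> are dense since
  \<open>\<phi> r s y\<close> tends to \<open>y\<close> as \<open>r\<close> increases to \<open>s\<close>, and both sides of the equation are continuous.\<close>
lemma trajectories_quotient_limit:
  assumes ev: "evolution_family d \<phi>" and s: "0 < s" "s < t"
    and m: "continuous_on UNIV m"
    and near: "\<And>r. r < 1 \<Longrightarrow> \<exists>C\<ge>0. \<forall>s u z. 0 \<le> s \<longrightarrow> s \<le> u \<longrightarrow> u \<le> t \<longrightarrow> cmod z \<le> r \<longrightarrow>
        cmod (\<phi> s u z - z) \<le> C * (m u - m s)"
    and L: "L holomorphic_on ball 0 1"
      "\<And>z w. cmod z < 1 \<Longrightarrow> (w \<longlongrightarrow> z) (at 0) \<Longrightarrow> ((\<lambda>h. s_quotient \<phi> s t (w h) h) \<longlongrightarrow> L z) (at 0)"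
    and G: "(\<lambda>z. G z s) holomorphic_on ball 0 1"
    and Z: "Z \<subseteq> ball 0 1" "ball 0 1 \<subseteq> closure Z"
    and traj: "\<And>r z. r \<in> \<rat> \<Longrightarrow> 0 \<le> r \<Longrightarrow> r < s \<Longrightarrow> z \<in> Z \<Longrightarrow>
       ((\<lambda>\<tau>. \<phi> r \<tau> z) has_vector_derivative G (\<phi> r s z) s) (at s)"
    and z: "cmod z < 1"
  shows "L z = - G z s * deriv (\<phi> s t) z"
proof -
  note hol = evolution_familyD(1)[OF ev] and self = evolution_familyD(2)[OF ev]
  let ?E = "\<lambda>w. L w + G w s * deriv (\<phi> s t) w"
  have on_traj: "?E (\<phi> r s y) = 0" if r: "r \<in> \<rat>" "0 \<le> r" "r < s" and y: "y \<in> Z" for r y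
  proof -
    have y1: "cmod y < 1" using y Z by auto
    let ?w = "\<phi> r s y"
    have w1: "cmod ?w < 1" using self[of r s y] r y1 by auto
    note tr = traj[OF r y]
    have "isCont (\<lambda>\<tau>. \<phi> r \<tau> y) s" using tr has_vector_derivative_continuous by blast
    then have "((\<lambda>h. \<phi> r (s + h) y) \<longlongrightarrow> ?w) (at 0)" by (simp add: isCont_iff)
    from L(2)[OF w1 this] have lim1: "((\<lambda>h. s_quotient \<phi> s t (\<phi> r (s + h) y) h) \<longlongrightarrow> L ?w) (at 0)" .
    \<comment> \<open>the same quotient, computed by the chain rule because \<open>\<phi> (s + h) t (\<phi> r (s + h) y)\<close> is constant\<close>
    have "((\<phi> s t \<circ> (\<lambda>\<tau>. \<phi> r \<tau> y)) has_vector_derivative G ?w s * deriv (\<phi> s t) ?w) (at s)"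
      using tr w1 s by (intro field_vector_diff_chain_at holomorphic_derivI[OF hol]) auto
    from has_vector_derivative_quotient[OF this]
    have lim2: "((\<lambda>h. - ((\<phi> s t (\<phi> r (s + h) y) - \<phi> s t ?w) / of_real h)) \<longlongrightarrow> - (G ?w s * deriv (\<phi> s t) ?w)) (at 0)"
      by (intro tendsto_minus) (simp add: o_def)
    have "\<forall>\<^sub>F h in at 0. s + h \<in> {r<..<t}"
      by (rule topological_tendstoD[where l = s]) (use s r in \<open>auto intro!: tendsto_eq_intros\<close>)
    then have "\<forall>\<^sub>F h in at 0. - ((\<phi> s t (\<phi> r (s + h) y) - \<phi> s t ?w) / of_real h)
        = s_quotient \<phi> s t (\<phi> r (s + h) y) h"
    proof eventually_elim
      case (elim h)
      have "\<phi> (s + h) t (\<phi> r (s + h) y) = \<phi> r t y" "\<phi> s t ?w = \<phi> r t y"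
        using r s elim y1 by (auto intro!: evolution_familyD(4)[OF ev])
      then show ?case by (simp add: s_quotient_def minus_divide_left)
    qed
    then have "((\<lambda>h. s_quotient \<phi> s t (\<phi> r (s + h) y) h) \<longlongrightarrow> - (G ?w s * deriv (\<phi> s t) ?w)) (at 0)"
      by (rule Lim_transform_eventually[OF lim2])
    with lim1 have "L ?w = - (G ?w s * deriv (\<phi> s t) ?w)"
      using tendsto_unique trivial_limit_at by blast
    then show ?thesis by simp
  qed
  have "?E z = 0"
  proof (rule ccontr)
    assume nz: "?E z \<noteq> 0"
    have "?E holomorphic_on ball 0 1"
      using s by (intro holomorphic_intros L G holomorphic_deriv hol) auto
    then have "isCont ?E z"
      using z by (intro continuous_on_interior[OF holomorphic_on_imp_continuous_on]) auto
    then obtain e where e: "e > 0" "\<And>y. dist y z < e \<Longrightarrow> ?E y \<noteq> 0"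
      using continuous_at_avoid[of z ?E 0] nz by (auto simp: dist_commute)
    obtain y where y: "y \<in> Z" "dist y z < e / 2"
      using Z(2) z e(1) by (meson closure_approachable half_gt_zero mem_ball_0 subsetD)
    have y1: "cmod y < 1" using y Z by auto
    obtain C where C: "C \<ge> 0" "\<And>s u z. 0 \<le> s \<Longrightarrow> s \<le> u \<Longrightarrow> u \<le> t \<Longrightarrow> cmod z \<le> cmod y \<Longrightarrow>
        cmod (\<phi> s u z - z) \<le> C * (m u - m s)" using near[OF y1] by blast
    have "((\<lambda>r. C * (m s - m r)) \<longlongrightarrow> C * (m s - m s)) (at_left s)"
      using m by (intro tendsto_intros) (auto simp: continuous_on_def intro: tendsto_within_subset)
    then have "\<forall>\<^sub>F r in at_left s. C * (m s - m r) < e / 2"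
      by (rule order_tendstoD) (use e in simp)
    then obtain b where b: "b < s" "\<And>r. b < r \<Longrightarrow> r < s \<Longrightarrow> C * (m s - m r) < e / 2"
      unfolding eventually_at_left_field by blast
    obtain r where r: "r \<in> \<rat>" "max 0 b < r" "r < s"
      using Rats_dense_in_real[of "max 0 b" s] b s by auto
    have "dist (\<phi> r s y) y < e / 2"
      using C(2)[of r s y] b(2)[of r] r s by (simp add: dist_norm)
    then have "dist (\<phi> r s y) z < e"
      using y(2) dist_triangle[of "\<phi> r s y" z y] by linarith
    moreover have "?E (\<phi> r s y) = 0" using r y by (intro on_traj) auto
    ultimately show False using e by blast
  qed
  then show ?thesis by (simp add: add_eq_0_iff2)
qed

lemma positive_trajectories_AE:
  assumes tr: "positive_trajectories G \<phi>" and Z: "countable Z" "Z \<subseteq> ball 0 1"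
  shows "\<exists>N \<in> null_sets lebesgue. \<forall>s r z. s \<notin> N \<longrightarrow> r \<in> \<rat> \<longrightarrow> 0 \<le> r \<longrightarrow> r < s \<longrightarrow> z \<in> Z \<longrightarrow>
       ((\<lambda>\<tau>. \<phi> r \<tau> z) has_vector_derivative G (\<phi> r s z) s) (at s)"
proof -
  let ?P = "\<lambda>r z s. r < s \<longrightarrow> ((\<lambda>\<tau>. \<phi> r \<tau> z) has_vector_derivative G (\<phi> r s z) s) (at s)"
  have "AE s in lebesgue. ?P r z s" if "r \<in> \<rat> \<inter> {0..}" "z \<in> Z" for r z
  proof -
    have "AE s in lebesgue_on {r..}. ((\<lambda>\<tau>. \<phi> r \<tau> z) has_vector_derivative G (\<phi> r s z) s) (at s within {r..})"
      using tr that Z unfolding positive_trajectories_def by auto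
    then have "AE s in lebesgue. s \<in> {r..} \<longrightarrow>
        ((\<lambda>\<tau>. \<phi> r \<tau> z) has_vector_derivative G (\<phi> r s z) s) (at s within {r..})"
      by (subst (asm) AE_restrict_space_iff) auto
    then show ?thesis
    proof eventually_elim
      case (elim s)
      show ?case
      proof
        assume "r < s"
        then have "at s within {r..} = at s" by (intro at_within_interior) auto
        then show "((\<lambda>\<tau>. \<phi> r \<tau> z) has_vector_derivative G (\<phi> r s z) s) (at s)"
          using elim \<open>r < s\<close> by simp
      qed
    qed
  qed
  then have "\<forall>r \<in> \<rat> \<inter> {0..}. \<forall>z \<in> Z. AE s in lebesgue. ?P r z s" by blast
  then have "AE s in lebesgue. \<forall>r \<in> \<rat> \<inter> {0..}. \<forall>z \<in> Z. ?P r z s"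
    unfolding AE_ball_countable[OF Z(1)] AE_ball_countable[OF countable_Int1[OF countable_rat]] .
  then obtain N where N: "{s \<in> space lebesgue. \<not> (\<forall>r \<in> \<rat> \<inter> {0..}. \<forall>z \<in> Z. ?P r z s)} \<subseteq> N"
    "emeasure lebesgue N = 0" "N \<in> sets lebesgue" by (rule AE_E)
  then show ?thesis by (intro bexI[of _ N]) auto
qed

theorem theorem6p6:
  fixes d :: ereal
    and \<phi> :: "real \<Rightarrow> real \<Rightarrow> complex \<Rightarrow> complex"
  assumes "1 \<le> d"
    and "evolution_family d \<phi>"
  shows "(\<forall>t>0. \<exists>N. N \<subseteq> {0..t} \<and> N \<in> null_sets lebesgue \<and>
            (\<forall>s \<in> {0<..<t} - N.
               (\<forall>z\<in>\<D>. \<exists>L. (s_quotient \<phi> s t z \<longlongrightarrow> L) (at 0)) \<and>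
               (\<lambda>z. Lim (at 0) (s_quotient \<phi> s t z)) holomorphic_on \<D>))
       \<and> (\<forall>(G :: complex \<Rightarrow> real \<Rightarrow> complex) (d' :: ereal).
            1 \<le> d' \<and> herglotz_vector_field d' G \<and> positive_trajectories G \<phi> \<longrightarrow>
            (\<forall>t>0. \<exists>N. N \<subseteq> {0..t} \<and> N \<in> null_sets lebesgue \<and>
               (\<forall>s \<in> {0<..<t} - N. \<forall>z\<in>\<D>.
                  (s_quotient \<phi> s t z \<longlongrightarrow> - G z s * deriv (\<phi> s t) z) (at 0))))"
proof (intro conjI allI impI)
  fix t :: real assume t: "0 < t"
  obtain m where m: "mono m" "continuous_on UNIV m"
    "\<And>r. r < 1 \<Longrightarrow> \<exists>C\<ge>0. \<forall>s u z. 0 \<le> s \<longrightarrow> s \<le> u \<longrightarrow> u \<le> t \<longrightarrow> cmod z \<le> r \<longrightarrow>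
        cmod (\<phi> s u z - z) \<le> C * (m u - m s)"
    using evolution_family_near_id[OF assms(2,1) t] by metis
  obtain N where N: "N \<in> null_sets lebesgue"
    "\<And>s. s \<in> {0<..<t} - N \<Longrightarrow> \<exists>L. L holomorphic_on ball 0 1 \<and>
    (\<forall>z w. cmod z < 1 \<longrightarrow> (w \<longlongrightarrow> z) (at 0) \<longrightarrow> ((\<lambda>h. s_quotient \<phi> s t (w h) h) \<longlongrightarrow> L z) (at 0))"
    using evolution_family_quotient_limit[OF assms(2) t m] by blast
  have lim: "(s_quotient \<phi> s t z \<longlongrightarrow> L z) (at 0)"
    if "\<forall>z w. cmod z < 1 \<longrightarrow> (w \<longlongrightarrow> z) (at 0) \<longrightarrow> ((\<lambda>h. s_quotient \<phi> s t (w h) h) \<longlongrightarrow> L z) (at 0)"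
      "z \<in> \<D>" for s z L
    using that(1)[rule_format, of z "\<lambda>_. z"] that(2) by simp
  show "\<exists>N. N \<subseteq> {0..t} \<and> N \<in> null_sets lebesgue \<and>
            (\<forall>s \<in> {0<..<t} - N.
               (\<forall>z\<in>\<D>. \<exists>L. (s_quotient \<phi> s t z \<longlongrightarrow> L) (at 0)) \<and>
               (\<lambda>z. Lim (at 0) (s_quotient \<phi> s t z)) holomorphic_on \<D>)"
  proof (intro exI[of _ "N \<inter> {0..t}"] conjI ballI)
    show "N \<inter> {0..t} \<in> null_sets lebesgue" using N(1) by (rule null_set_Int2) auto
    fix s assume "s \<in> {0<..<t} - N \<inter> {0..t}"
    then have "s \<in> {0<..<t} - N" by auto
    then obtain L where L: "L holomorphic_on \<D>"
      "\<forall>z w. cmod z < 1 \<longrightarrow> (w \<longlongrightarrow> z) (at 0) \<longrightarrow> ((\<lambda>h. s_quotient \<phi> s t (w h) h) \<longlongrightarrow> L z) (at 0)"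
      using N(2) by blast
    note l = lim[OF L(2)]
    show "\<exists>L. (s_quotient \<phi> s t z \<longlongrightarrow> L) (at 0)" if "z \<in> \<D>" for z using l[OF that] by blast
    have "Lim (at 0) (s_quotient \<phi> s t z) = L z" if "z \<in> \<D>" for z
      using l[OF that] by (rule tendsto_Lim[OF trivial_limit_at])
    then show "(\<lambda>z. Lim (at 0) (s_quotient \<phi> s t z)) holomorphic_on \<D>"
      using L(1) by (subst holomorphic_cong[OF refl]) auto
  qed simp
  fix G :: "complex \<Rightarrow> real \<Rightarrow> complex" and d' :: ereal
  assume *: "1 \<le> d' \<and> herglotz_vector_field d' G \<and> positive_trajectories G \<phi>"
  obtain Z :: "complex set" where Z: "countable Z" "Z \<subseteq> ball 0 1" "ball 0 1 \<subseteq> closure Z"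
    using separable by blast
  obtain N' where N': "N' \<in> null_sets lebesgue"
    "\<And>s r z. s \<notin> N' \<Longrightarrow> r \<in> \<rat> \<Longrightarrow> 0 \<le> r \<Longrightarrow> r < s \<Longrightarrow> z \<in> Z \<Longrightarrow>
       ((\<lambda>\<tau>. \<phi> r \<tau> z) has_vector_derivative G (\<phi> r s z) s) (at s)"
    using positive_trajectories_AE[OF _ Z(1,2), of G \<phi>] * by blast
  show "\<exists>N. N \<subseteq> {0..t} \<and> N \<in> null_sets lebesgue \<and>
               (\<forall>s \<in> {0<..<t} - N. \<forall>z\<in>\<D>.
                  (s_quotient \<phi> s t z \<longlongrightarrow> - G z s * deriv (\<phi> s t) z) (at 0))"
  proof (intro exI[of _ "(N \<union> N') \<inter> {0..t}"] conjI ballI)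
    show "(N \<union> N') \<inter> {0..t} \<in> null_sets lebesgue"
      using N(1) N'(1) by (intro null_set_Int2 null_sets.Un) auto
    fix s z assume s: "s \<in> {0<..<t} - (N \<union> N') \<inter> {0..t}" and z: "z \<in> \<D>"
    then have sN: "s \<in> {0<..<t} - N" "s \<notin> N'" by auto
    then obtain L where L: "L holomorphic_on \<D>"
      "\<forall>z w. cmod z < 1 \<longrightarrow> (w \<longlongrightarrow> z) (at 0) \<longrightarrow> ((\<lambda>h. s_quotient \<phi> s t (w h) h) \<longlongrightarrow> L z) (at 0)"
      using N(2) by blast
    have "(\<lambda>z. G z s) holomorphic_on \<D>"
      using * s by (auto simp: herglotz_vector_field_def weak_holomorphic_vector_field_def)
    then have "L z = - G z s * deriv (\<phi> s t) z"
      using s z N'(2)[OF sN(2)] m(3) L(2)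
      by (intro trajectories_quotient_limit[where m = m and Z = Z, OF assms(2) _ _ m(2) _ L(1) _ _ Z(2,3)]) auto
    then show "(s_quotient \<phi> s t z \<longlongrightarrow> - G z s * deriv (\<phi> s t) z) (at 0)"
      using lim[OF L(2) z] by simp
  qed simp
qed

end
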